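(* Let $$\langle f,g \rangle= \int_{-1}^{1} f(x) g(x) \,d\mu(x) +\sum_{j=1}^{N} \eta_{j,d_j} \,f^{(d_j)}(c_{j})\, g^{(d_j)}(c_{j})$$ be a sequentially-ordered discrete Sobolev inner product with $\mu\in\mathbf{M}(0,1)$, and let $S_n$ be the monic polynomial of degree $n$ with $\langle x^k,S_n\rangle=0$ for $k=0,\dots,n-1$. Then: 1. There is $\varepsilon>0$ such that for any choice of neighborhoods $V_j$ of $c_j$ in $\mathbb{C}$ contained in the disc $\{|z-c_j|<\varepsilon\}$, $j=1,\dots,N$, the following holds for all $n$ sufficiently large: each $V_j$ contains exactly one zero of $S_n$, and the remaining $n-N$ zeros of $S_n$ lie on $(-1,1)$. 2. For all $n$ sufficiently large, the zeros of $S_n$ are real and simple. 3. The set of zeros of $\{S_n\}_{n=1}^\infty$ is uniformly bounded, i.e. there is a constant $C$ such that every zero of every $S_n$, $n\ge1$, has modulus at most $C$.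
   Context: $\mu$ is a finite positive Borel measure on $[-1,1]$ whose support contains infinitely many points; $N\ge 0$ is an integer, $\eta_{j,d_j}>0$, $c_j\in\mathbb{R}\setminus[-1,1]$, and $d_j\in\mathbb{Z}_+=\{0,1,2,\dots\}$ for $j=1,\dots,N$. Zeros are counted with multiplicity. Sequentially-ordered: the inner product is called sequentially-ordered if the pairs $(c_j,d_j)$, $1\le j\le N$, can be arranged into a finite sequence $(r_1,\nu_1),\dots,(r_N,\nu_N)$ such that (1) $0\le \nu_1\le\cdots\le\nu_N$, and (2) for each $k=1,\dots,N$, $r_k$ does not belong to the convex hull of $(-1,1)\cup\{r_1,\dots,r_{k-1}\}$. Nevai class: $\mu\in\mathbf{M}(0,1)$ means that $\operatorname{supp}\mu=[-1,1]$ and the monic orthogonal polynomials $P_n$ of $\mu$, which satisfy $P_{n+1}(z)=(z-b_n)P_n(z)-a_n^2P_{n-1}(z)$ with $P_{-1}=0$, $P_0=1$, $b_n\in\mathbb{R}$, $a_n>0$ for $n\ge1$, have $\lim_{n\to\infty} a_n=1/2$ and $\lim_{n\to\infty} b_n=0$. *)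

theory Defs
  imports
    "HOL-Analysis.Analysis"
    "HOL-Computational_Algebra.Computational_Algebra"
begin

text \<open>
  A finite positive Borel measure on \<open>[-1, 1]\<close> is represented as a finite Borel measure on the
  whole real line that gives the complement of \<open>[-1, 1]\<close> measure zero.
\<close>

definition borel_measure_on_Icc :: "real measure \<Rightarrow> bool" where
  "borel_measure_on_Icc M \<longleftrightarrow>
     sets M = sets borel \<and> finite_measure M \<and> emeasure M (- {-1..1}) = 0"

definition measure_support :: "'a::topological_space measure \<Rightarrow> 'a set" where
  "measure_support M = {x. \<forall>U. open U \<and> x \<in> U \<longrightarrow> emeasure M U > 0}"

definition L2_ip :: "real measure \<Rightarrow> real poly \<Rightarrow> real poly \<Rightarrow> real" where
  "L2_ip M f g = (LINT x:{-1..1}|M. poly f x * poly g x)"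

text \<open>Here \<open>\<eta> j\<close> stands for the mass \<open>\<eta>\<^sub>j\<^sub>,\<^sub>d\<close> with \<open>d = d j\<close>.\<close>

definition sobolev_ip ::
  "real measure \<Rightarrow> nat \<Rightarrow> (nat \<Rightarrow> real) \<Rightarrow> (nat \<Rightarrow> real) \<Rightarrow> (nat \<Rightarrow> nat) \<Rightarrow>
   real poly \<Rightarrow> real poly \<Rightarrow> real" where
  "sobolev_ip M N \<eta> c d f g =
     (LINT x:{-1..1}|M. poly f x * poly g x) +
     (\<Sum>j=1..N. \<eta> j * poly ((pderiv ^^ d j) f) (c j) * poly ((pderiv ^^ d j) g) (c j))"

definition monic_orthogonal ::
  "(real poly \<Rightarrow> real poly \<Rightarrow> real) \<Rightarrow> (nat \<Rightarrow> real poly) \<Rightarrow> bool" where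
  "monic_orthogonal ip P \<longleftrightarrow>
     (\<forall>n. degree (P n) = n \<and> lead_coeff (P n) = 1 \<and> (\<forall>k<n. ip (monom 1 k) (P n) = 0))"

text \<open>The coefficient \<open>a 0\<close> is irrelevant, as it would multiply \<open>P\<close> with index \<open>-1\<close>, which is 0.\<close>

definition nevai_class_0_1 :: "real measure \<Rightarrow> bool" where
  "nevai_class_0_1 M \<longleftrightarrow>
     measure_support M = {-1..1} \<and>
     (\<exists>P a b. monic_orthogonal (L2_ip M) P \<and>
        P 1 = [:- b 0, 1:] * P 0 \<and>
        (\<forall>n\<ge>1. P (n + 1) = [:- b n, 1:] * P n - smult ((a n)\<^sup>2) (P (n - 1))) \<and>
        (\<forall>n\<ge>1. a n > 0) \<and>
        a \<longlonglongrightarrow> 1 / 2 \<and> b \<longlonglongrightarrow> 0)"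

text \<open>The rearranged pairs are \<open>(r\<^sub>k, \<nu>\<^sub>k) = (c (\<pi> k), d (\<pi> k))\<close>.\<close>

definition sequentially_ordered :: "nat \<Rightarrow> (nat \<Rightarrow> real) \<Rightarrow> (nat \<Rightarrow> nat) \<Rightarrow> bool" where
  "sequentially_ordered N c d \<longleftrightarrow>
     (\<exists>\<pi>. bij_betw \<pi> {1..N} {1..N} \<and>
        (\<forall>i\<in>{1..N}. \<forall>j\<in>{1..N}. i \<le> j \<longrightarrow> d (\<pi> i) \<le> d (\<pi> j)) \<and>
        (\<forall>k\<in>{1..N}. c (\<pi> k) \<notin> convex hull ({-1<..<1} \<union> (\<lambda>i. c (\<pi> i)) ` {1..<k})))"

text \<open>The multiset of all complex zeros of a real polynomial, with multiplicity.\<close>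

definition czeros :: "real poly \<Rightarrow> complex multiset" where
  "czeros p = proots (map_poly complex_of_real p)"

end

theory Submission
  imports Defs
begin

text \<open>
  The zeros of \<open>S n\<close> are located by counting. Two facts are needed.

  \<^item> \<open>S n\<close> has at least \<open>n - N\<close> distinct zeros in \<open>(-1, 1)\<close> (\<open>exists_zeros_inside\<close>).
  \<^item> Every neighbourhood of every \<open>c j\<close> contains a zero of \<open>S n\<close> once \<open>n\<close> is large
    (\<open>sobolev_zero_near_mass_point\<close>).

  If the neighbourhoods are disjoint from each other and from \<open>[-1, 1]\<close>, these are already \<open>n\<close> distinct
  zeros, so \<open>S n\<close> has no others and all of them are simple. The zero close to \<open>c j\<close> is real because
  its conjugate is a zero in the same disc. Boundedness follows, as only finitely many \<open>n\<close> are small.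

  The first fact is the place where sequential ordering matters. If \<open>S n\<close> had fewer than \<open>n - N\<close>
  zeros of odd order in \<open>(-1, 1)\<close>, linear algebra would give a polynomial \<open>Q\<close> of degree less than
  \<open>n\<close> that vanishes at these zeros and satisfies \<open>Q\<^sup>(\<^sup>d\<^sup>)(c) = 0\<close> for every pair \<open>(c, d)\<close>. A count by
  Rolle's theorem (\<open>zeros_plus_constraints_le_degree\<close>) shows that such a \<open>Q\<close> can be chosen with no
  further zeros in \<open>(-1, 1)\<close>. Then \<open>Q * S n\<close> has constant sign there, while orthogonality
  makes its integral zero.

  For the second fact suppose that \<open>S n\<close> has no zero within \<open>\<delta>\<close> of \<open>c = c j\<close>, and let \<open>P n\<close> be the
  monic orthogonal polynomials of the measure with squared norms \<open>\<tau> n\<close>. With \<open>C\<close> standing for positive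
  constants that do not depend on \<open>n\<close>, four estimates hold for large \<open>n\<close>.

  \<^item> The minimality of the Sobolev norm of \<open>S n\<close>, tested against \<open>w * P (n - m)\<close> with a fixed
    polynomial \<open>w\<close> of degree \<open>m\<close> that has a zero of order \<open>d j + 1\<close> at each \<open>c j\<close>,
    gives \<open>\<bar>(S n)\<^sup>(\<^sup>d\<^sup>)(c)\<bar> \<le> C sqrt (\<tau> (n - m))\<close>, and this is at most \<open>C sqrt (\<tau> n)\<close> because the
    Nevai class condition keeps the ratios \<open>\<tau> (n + 1) / \<tau> n\<close> away from 0.
  \<^item> \<open>\<bar>S n(c)\<bar> \<le> \<bar>(S n)\<^sup>(\<^sup>d\<^sup>)(c)\<bar>\<close>: each logarithmic derivative picks up a sum of
    about \<open>n\<close> terms \<open>1 / (c - x)\<close> of equal sign from the zeros in \<open>(-1, 1)\<close>, and the at most \<open>N\<close>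
    other zeros contribute a bounded amount (\<open>abs_poly_le_abs_higher_pderiv\<close>).
  \<^item> \<open>C \<bar>P n(c)\<bar> \<le> \<bar>S n(c)\<bar>\<close>: \<open>w * S n\<close> is orthogonal to all polynomials of degree less
    than \<open>n - m\<close>, so by Gauss quadrature it changes sign at least \<open>n - m\<close> times along the zeros of \<open>P n\<close>.
    At least \<open>n - m\<close> zeros of \<open>S n\<close> therefore interlace with zeros of \<open>P n\<close>
    (\<open>quasi_orthogonal_zeros\<close>), and the remaining ones have distance at least \<open>\<delta>\<close> from \<open>c\<close>.
  \<^item> \<open>C \<bar>c\<bar>\<^sup>n sqrt (\<tau> n) \<le> \<bar>P n(c)\<bar>\<close> (\<open>orthogonal_monic_growth\<close>).

  Together they bound \<open>\<bar>c\<bar>\<^sup>n\<close>, which is absurd since \<open>\<bar>c\<bar> > 1\<close>.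
  The argument uses the integral only as a positive linear functional on polynomials and is carried
  out in that generality.
\<close>

section \<open>Linear functionals on polynomials\<close>

definition linfun :: "(real poly \<Rightarrow> real) \<Rightarrow> bool" where
  "linfun f \<longleftrightarrow> (\<forall>p q. f (p + q) = f p + f q) \<and> (\<forall>a p. f (smult a p) = a * f p)"

lemma linfun_add: "linfun f \<Longrightarrow> f (p + q) = f p + f q"
  and linfun_smult: "linfun f \<Longrightarrow> f (smult a p) = a * f p"
  by (auto simp: linfun_def)

lemma linfun_0: "linfun f \<Longrightarrow> f 0 = 0"
  using linfun_smult[of f 0 0] by simp

lemma linfun_diff: "linfun f \<Longrightarrow> f (p - q) = f p - f q"
  using linfun_add[of f p "smult (-1) q"] linfun_smult[of f "-1" q] by simp

lemma linfun_sum: "linfun f \<Longrightarrow> f (\<Sum>i\<in>A. g i) = (\<Sum>i\<in>A. f (g i))"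
  by (induction A rule: infinite_finite_induct) (auto simp: linfun_0 linfun_add)

lemma linfun_poly_higher_pderiv: "linfun (\<lambda>p. poly ((pderiv ^^ n) p) x)"
  by (simp add: linfun_def higher_pderiv_add higher_pderiv_smult)

lemma linfun_poly: "linfun (\<lambda>p. poly p x)"
  by (simp add: linfun_def)

text \<open>
  Elimination, one functional \<open>g\<close> at a time: the polynomial of least degree on which \<open>g\<close> does not
  vanish serves as pivot and is subtracted from those of higher degree, whose degrees do not change.
  The last conjunct says that \<open>q\<close> lies in the span of the given polynomials; the induction
  needs it to know that later steps preserve the vanishing of earlier functionals.
\<close>
lemma exists_poly_killed_by_functionals:
  fixes F :: "(real poly \<Rightarrow> real) set" and p :: "nat \<Rightarrow> real poly"
  assumes "finite F" "\<And>f. f \<in> F \<Longrightarrow> linfun f"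
    and "finite A" "card F < card A" "\<And>i. i \<in> A \<Longrightarrow> p i \<noteq> 0 \<and> degree (p i) = i"
  shows "\<exists>q. q \<noteq> 0 \<and> degree q \<in> A \<and> (\<forall>f\<in>F. f q = 0) \<and>
           (\<forall>f. linfun f \<longrightarrow> (\<forall>i\<in>A. f (p i) = 0) \<longrightarrow> f q = 0)"
  using assms
proof (induction F arbitrary: A p rule: finite_induct)
  case empty
  from empty.prems(3) have "A \<noteq> {}" by (cases "A = {}") simp_all
  then obtain i where "i \<in> A" by blast
  then have pi: "p i \<noteq> 0" "degree (p i) = i" using empty.prems(4) by blast+
  show ?case
  proof (intro exI[of _ "p i"] conjI ballI allI impI)
    show "p i \<noteq> 0" by (rule pi)
    show "degree (p i) \<in> A" unfolding pi(2) by fact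
    show "f (p i) = 0" if "\<forall>i\<in>A. f (p i) = 0" for f :: "real poly \<Rightarrow> real"
      using that \<open>i \<in> A\<close> by (rule bspec)
  qed simp
next
  case (insert g F)
  show ?case
  proof (cases "\<forall>i\<in>A. g (p i) = 0")
    case True
    have "\<exists>q. q \<noteq> 0 \<and> degree q \<in> A \<and> (\<forall>f\<in>F. f q = 0) \<and>
           (\<forall>f. linfun f \<longrightarrow> (\<forall>i\<in>A. f (p i) = 0) \<longrightarrow> f q = 0)"
    proof (rule insert.IH)
      show "card F < card A" using insert.prems(3) insert.hyps by simp
    qed (use insert.prems in blast)+
    then obtain q where q: "q \<noteq> 0" "degree q \<in> A" "\<And>f. f \<in> F \<Longrightarrow> f q = 0"
      "\<And>f. linfun f \<Longrightarrow> (\<And>i. i \<in> A \<Longrightarrow> f (p i) = 0) \<Longrightarrow> f q = 0"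
      by metis
    have "g q = 0" using True insert.prems(1) by (intro q(4)[of g]) auto
    with q show ?thesis by (intro exI[of _ q]) auto
  next
    case False
    have lin: "linfun g" using insert.prems by auto
    define j where "j = Min {i \<in> A. g (p i) \<noteq> 0}"
    have "j \<in> {i \<in> A. g (p i) \<noteq> 0}"
      unfolding j_def using False insert.prems(2) by (intro Min_in) auto
    then have j: "j \<in> A" "g (p j) \<noteq> 0" by auto
    have below: "g (p i) = 0" if "i \<in> A" "i < j" for i
    proof (rule ccontr)
      assume "g (p i) \<noteq> 0"
      then have "j \<le> i" unfolding j_def using that insert.prems(2) by (intro Min_le) auto
      with that show False by simp
    qed
    define r where "r i = p i - smult (g (p i) / g (p j)) (p j)" for i
    have r: "r i \<noteq> 0 \<and> degree (r i) = i" if i: "i \<in> A - {j}" for i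
    proof (cases "i < j")
      case True
      then have "r i = p i" using below i by (simp add: r_def)
      with i show ?thesis using insert.prems(4) by simp
    next
      case False
      with i have "j < i" by auto
      moreover have "degree (p i) = i" "degree (p j) = j" using i j insert.prems(4) by blast+
      ultimately have "degree (smult (g (p i) / g (p j)) (p j)) < degree (p i)"
        by (metis degree_smult_le le_less_trans)
      then have "degree (r i) = i"
        unfolding r_def diff_conv_add_uminus using \<open>degree (p i) = i\<close>
        by (subst degree_add_eq_left) auto
      with \<open>j < i\<close> show ?thesis by auto
    qed
    have "\<exists>q. q \<noteq> 0 \<and> degree q \<in> A - {j} \<and> (\<forall>f\<in>F. f q = 0) \<and>
           (\<forall>f. linfun f \<longrightarrow> (\<forall>i\<in>A - {j}. f (r i) = 0) \<longrightarrow> f q = 0)"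
    proof (rule insert.IH)
      show "card F < card (A - {j})" using insert.prems(2,3) insert.hyps j(1) by simp
    qed (use insert.prems r in blast)+
    then obtain q where q: "q \<noteq> 0" "degree q \<in> A - {j}" "\<forall>f\<in>F. f q = 0"
      "\<And>f. linfun f \<Longrightarrow> (\<And>i. i\<in>A - {j} \<Longrightarrow> f (r i) = 0) \<Longrightarrow> f q = 0"
      by metis
    have "g q = 0"
      using lin j by (intro q(4)[of g]) (auto simp: r_def linfun_diff linfun_smult)
    moreover have "f q = 0" if "linfun f" "\<forall>i\<in>A. f (p i) = 0" for f
      using that j by (intro q(4)[of f]) (auto simp: r_def linfun_diff linfun_smult)
    ultimately show ?thesis using q by blast
  qed
qed

section \<open>Counting zeros by Rolle's theorem\<close>
definition zeros_in :: "real poly \<Rightarrow> real set \<Rightarrow> nat" where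
  "zeros_in p J = size {#x \<in># proots p. x \<in> J#}"

lemma zeros_in_eq_sum:
  assumes "p \<noteq> 0"
  shows "zeros_in p J = (\<Sum>x | x \<in> J \<and> poly p x = 0. order x p)"
proof -
  have "{x. x \<in> J \<and> poly p x = 0} = {x \<in> set_mset (proots p). x \<in> J}" using assms by auto
  then show ?thesis using assms
    by (auto simp: zeros_in_def size_multiset_overloaded_eq intro!: sum.cong)
qed

lemma zeros_in_le_degree: "zeros_in p J \<le> degree p"
  unfolding zeros_in_def using size_filter_mset_lesseq size_proots_le le_trans by blast

lemma sum_order_le_zeros_in:
  assumes "p \<noteq> 0" "finite A" "A \<subseteq> J"
  shows "(\<Sum>x\<in>A. order x p) \<le> zeros_in p J"
proof -
  have "(\<Sum>x\<in>A. order x p) = (\<Sum>x\<in>{x\<in>A. poly p x = 0}. order x p)"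
    using assms by (intro sum.mono_neutral_right) (auto simp: order_root)
  also have "\<dots> \<le> (\<Sum>x | x \<in> J \<and> poly p x = 0. order x p)"
    using assms poly_roots_finite[of p] by (intro sum_mono2) auto
  finally show ?thesis using assms by (simp add: zeros_in_eq_sum)
qed

lemma zeros_in_add_card_le:
  assumes "p \<noteq> 0" "finite C" "C \<inter> A = {}" "A \<subseteq> B" "C \<subseteq> B" "\<And>x. x \<in> C \<Longrightarrow> poly p x = 0"
  shows "zeros_in p A + card C \<le> zeros_in p B"
proof -
  have fin: "finite {x. x \<in> A \<and> poly p x = 0}" using assms poly_roots_finite[of p] by auto
  have "card C \<le> (\<Sum>x\<in>C. order x p)"
    using assms by (subst card_eq_sum, intro sum_mono) (auto simp: order_root Suc_le_eq)
  moreover have "(\<Sum>x\<in>{x. x \<in> A \<and> poly p x = 0} \<union> C. order x p) \<le> zeros_in p B"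
    using assms fin by (intro sum_order_le_zeros_in) auto
  moreover have "(\<Sum>x\<in>{x. x \<in> A \<and> poly p x = 0} \<union> C. order x p)
     = (\<Sum>x\<in>{x. x \<in> A \<and> poly p x = 0}. order x p) + (\<Sum>x\<in>C. order x p)"
    using assms fin by (intro sum.union_disjoint) auto
  ultimately show ?thesis using assms by (simp add: zeros_in_eq_sum)
qed

lemma rolle_between_roots:
  fixes p :: "real poly"
  assumes "finite X" "X \<noteq> {}" "\<And>x. x \<in> X \<Longrightarrow> poly p x = 0"
  shows "\<exists>B. finite B \<and> card B + 1 = card X \<and> B \<inter> X = {} \<and>
           (\<forall>b\<in>B. poly (pderiv p) b = 0 \<and> (\<exists>x\<in>X. \<exists>y\<in>X. x < b \<and> b < y))"
  using assms
proof (induction X rule: finite_linorder_max_induct)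
  case empty
  then show ?case by simp
next
  case (insert b A)
  show ?case
  proof (cases "A = {}")
    case True
    then show ?thesis by (intro exI[of _ "{}"]) auto
  next
    case False
    then obtain B where B: "finite B" "card B + 1 = card A" "B \<inter> A = {}"
      "\<And>z. z \<in> B \<Longrightarrow> poly (pderiv p) z = 0 \<and> (\<exists>x\<in>A. \<exists>y\<in>A. x < z \<and> z < y)"
      using insert by (metis insert_iff)
    have M: "Max A \<in> A" "Max A < b" using False insert by auto
    obtain t where t: "Max A < t" "t < b" "poly p b - poly p (Max A) = (b - Max A) * poly (pderiv p) t"
      using poly_MVT[OF M(2), of p] by blast
    have "poly (pderiv p) t = 0" using t M insert.prems by auto
    have lt: "z < Max A" if "z \<in> B" for z
      using B(4)[OF that] insert.hyps(1) by (meson Max_ge less_le_trans)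
    have "t \<notin> B" using lt t by force
    have "t \<notin> A" using t insert.hyps(1) by (meson Max_ge leD)
    have "b \<notin> A" using insert.hyps by auto
    have "insert t B \<inter> insert b A = {}"
      using B(3) lt M(2) t \<open>t \<notin> A\<close> by force
    moreover have "card (insert t B) + 1 = card (insert b A)"
      using B \<open>t \<notin> B\<close> \<open>b \<notin> A\<close> insert.hyps by simp
    moreover have "\<forall>z\<in>insert t B. poly (pderiv p) z = 0 \<and> (\<exists>x\<in>insert b A. \<exists>y\<in>insert b A. x < z \<and> z < y)"
      using B(4) M t \<open>poly (pderiv p) t = 0\<close> by blast
    ultimately show ?thesis using B(1) by (intro exI[of _ "insert t B"]) auto
  qed
qed

text \<open>
  A zero of multiplicity \<open>k\<close> of \<open>p\<close> is one of multiplicity \<open>k - 1\<close> of the derivative, and Rolle's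
  theorem adds one zero between any two neighbours.
\<close>
lemma zeros_in_pderiv:
  assumes J: "convex J" and p: "pderiv p \<noteq> 0"
  shows "zeros_in p J \<le> zeros_in (pderiv p) J + 1"
proof -
  have p0: "p \<noteq> 0" using p by auto
  define X where "X = {x. x \<in> J \<and> poly p x = 0}"
  have fin: "finite X" unfolding X_def using poly_roots_finite[OF p0] by auto
  show ?thesis
  proof (cases "X = {}")
    case True
    then have "zeros_in p J = 0" unfolding zeros_in_eq_sum[OF p0] X_def by (simp only: sum.empty)
    then show ?thesis by simp
  next
    case False
    obtain B where B: "finite B" "card B + 1 = card X" "B \<inter> X = {}"
      "\<And>z. z \<in> B \<Longrightarrow> poly (pderiv p) z = 0 \<and> (\<exists>x\<in>X. \<exists>y\<in>X. x < z \<and> z < y)"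
      using rolle_between_roots[OF fin False, of p] by (auto simp: X_def)
    have BJ: "B \<subseteq> J"
    proof
      fix z assume "z \<in> B"
      then obtain x y where "x \<in> X" "y \<in> X" "x < z" "z < y" using B(4) by blast
      then show "z \<in> J"
        using J unfolding X_def is_interval_convex_1[symmetric] is_interval_1 by (auto intro: less_imp_le)
    qed
    have "zeros_in p J = (\<Sum>x\<in>X. order x p)"
      using p0 by (simp add: zeros_in_eq_sum X_def)
    also have "\<dots> = (\<Sum>x\<in>X. order x (pderiv p) + 1)"
    proof (intro sum.cong refl)
      fix x assume "x \<in> X"
      then show "order x p = order x (pderiv p) + 1"
        using order_pderiv[OF p0, of x] by (simp add: X_def)
    qed
    also have "\<dots> = (\<Sum>x\<in>X. order x (pderiv p)) + card B + 1"
      unfolding sum.distrib using B(2) by simp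
    also have "card B \<le> (\<Sum>x\<in>B. order x (pderiv p))"
      using B p by (subst card_eq_sum, intro sum_mono) (auto simp: order_root Suc_le_eq)
    also have "(\<Sum>x\<in>X. order x (pderiv p)) + (\<Sum>x\<in>B. order x (pderiv p))
       = (\<Sum>x\<in>X \<union> B. order x (pderiv p))"
      using B fin by (intro sum.union_disjoint[symmetric]) auto
    also have "\<dots> \<le> zeros_in (pderiv p) J"
      using B fin BJ p by (intro sum_order_le_zeros_in) (auto simp: X_def)
    finally show ?thesis by simp
  qed
qed

text \<open>
  The part of sequential ordering that the zero count needs, in a form without the permutation: for the
  constraints \<open>f\<^sup>(\<^sup>d\<^sup>)(c) = 0\<close>, each point lies outside the hull of \<open>(-1, 1)\<close> and the points
  that carry a derivative of lower order.
\<close>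
definition nested_constraints :: "'i set \<Rightarrow> ('i \<Rightarrow> real) \<Rightarrow> ('i \<Rightarrow> nat) \<Rightarrow> bool" where
  "nested_constraints J c d \<longleftrightarrow> finite J \<and> inj_on c J \<and>
     (\<forall>j\<in>J. c j \<notin> convex hull ({-1<..<1} \<union> c ` {i \<in> J. d i < d j}))"

lemma higher_pderiv_nonzero:
  fixes p :: "real poly"
  assumes "p \<noteq> 0" "n \<le> degree p"
  shows "(pderiv ^^ n) p \<noteq> 0"
proof
  assume "(pderiv ^^ n) p = 0"
  then have "coeff ((pderiv ^^ n) p) (degree p - n) = 0" by simp
  then have "coeff p (degree p) = 0"
    using assms(2) by (simp add: coeff_higher_pderiv pochhammer_eq_0_iff)
  with assms show False by simp
qed

text \<open>
  Follow the zeros of \<open>f\<^sup>(\<^sup>t\<^sup>)\<close> in the hull \<open>H t\<close> of \<open>(-1, 1)\<close> and all points of order at most \<open>t\<close>. Passing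
  from \<open>t\<close> to \<open>t + 1\<close> loses at most one zero by Rolle's theorem and gains the points of order \<open>t + 1\<close>,
  which are new because they lie outside \<open>H t\<close>. At \<open>t = degree f\<close> no zeros are left. Constraints of
  order above the degree hold trivially and must not be counted.
\<close>
lemma zeros_plus_constraints_le_degree:
  assumes nest: "nested_constraints J c d" and f: "f \<noteq> 0"
    and zero: "\<And>j. j \<in> J \<Longrightarrow> poly ((pderiv ^^ d j) f) (c j) = 0"
  shows "zeros_in f {-1<..<1} + card {j \<in> J. d j \<le> degree f} \<le> degree f"
proof -
  define H where "H t = convex hull ({-1<..<1} \<union> c ` {i \<in> J. d i \<le> t})" for t
  have finJ: "finite J" and inj: "inj_on c J" using nest by (auto simp: nested_constraints_def)
  have notin: "c j \<notin> convex hull ({-1<..<1} \<union> c ` {i \<in> J. d i < d j})" if "j \<in> J" for j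
    using nest that by (auto simp: nested_constraints_def)
  have sub: "{-1<..<1} \<union> c ` {i \<in> J. d i \<le> t} \<subseteq> H t" for t
    unfolding H_def by (rule hull_subset)
  have card_c: "card (c ` {j \<in> J. d j = t}) = card {j \<in> J. d j = t}" for t
    using inj by (intro card_image) (auto simp: inj_on_def)
  have "zeros_in f {-1<..<1} + card {j \<in> J. d j \<le> t} \<le> zeros_in ((pderiv ^^ t) f) (H t) + t"
    if "t \<le> degree f" for t
    using that
  proof (induction t)
    case 0
    have "zeros_in f {-1<..<1} + card (c ` {j \<in> J. d j = 0}) \<le> zeros_in f (H 0)"
    proof (rule zeros_in_add_card_le)
      show "c ` {j \<in> J. d j = 0} \<inter> {-1<..<1} = {}"
        using notin hull_subset[of "{-1<..<1::real}" convex] by force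
      show "poly f x = 0" if "x \<in> c ` {j \<in> J. d j = 0}" for x
        using that zero by force
    qed (use f finJ sub[of 0] in auto)
    then show ?case by (simp add: card_c)
  next
    case (Suc t)
    let ?g = "(pderiv ^^ t) f"
    have ne: "pderiv ?g \<noteq> 0" using higher_pderiv_nonzero[OF f, of "Suc t"] Suc.prems by simp
    have "zeros_in (pderiv ?g) (H t) + card (c ` {j \<in> J. d j = Suc t}) \<le> zeros_in (pderiv ?g) (H (Suc t))"
    proof (rule zeros_in_add_card_le)
      show "c ` {j \<in> J. d j = Suc t} \<inter> H t = {}"
      proof (rule equals0I)
        fix x assume "x \<in> c ` {j \<in> J. d j = Suc t} \<inter> H t"
        then obtain j where j: "j \<in> J" "d j = Suc t" "c j \<in> H t" by auto
        then show False using notin[of j] by (simp add: H_def less_Suc_eq_le)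
      qed
      show "H t \<subseteq> H (Suc t)" unfolding H_def by (intro hull_mono) auto
      show "poly (pderiv ?g) x = 0" if "x \<in> c ` {j \<in> J. d j = Suc t}" for x
        using that zero by force
    qed (use ne finJ sub[of "Suc t"] in auto)
    moreover have "zeros_in ?g (H t) \<le> zeros_in (pderiv ?g) (H t) + 1"
      using ne by (intro zeros_in_pderiv) (auto simp: H_def)
    moreover have "card {j \<in> J. d j \<le> Suc t} = card {j \<in> J. d j \<le> t} + card {j \<in> J. d j = Suc t}"
      using finJ by (subst card_Un_disjoint[symmetric]) (auto intro!: arg_cong[where f=card])
    ultimately show ?case using Suc by (simp add: card_c)
  qed
  from this[of "degree f"] show ?thesis
    using zeros_in_le_degree[of "(pderiv ^^ degree f) f" "H (degree f)"]
    by (simp add: degree_higher_pderiv)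
qed

text \<open>
  Linear algebra alone gives a polynomial with the required zeros, and the count above excludes
  superfluous ones provided that no degree is wasted on trivial constraints. Therefore \<open>D\<close> is chosen as the least
  number that is at least \<open>card X\<close> plus the number of constraints of order at most \<open>D\<close>. Minimality turns this
  inequality into an equality, so that one more zero would violate the count.
\<close>
lemma exists_poly_with_exact_zeros:
  assumes nest: "nested_constraints J c d" and X: "finite X" "X \<subseteq> {-1<..<1}"
  shows "\<exists>Q. Q \<noteq> 0 \<and> degree Q \<le> card X + card J \<and>
           (\<forall>j\<in>J. poly ((pderiv ^^ d j) Q) (c j) = 0) \<and>
           (\<forall>x\<in>{-1<..<1}. order x Q = (if x \<in> X then 1 else 0))"
proof -
  have finJ: "finite J" using nest by (auto simp: nested_constraints_def)
  define R where "R D \<longleftrightarrow> card X + card {j \<in> J. d j \<le> D} \<le> D" for D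
  define D where "D = (LEAST D. R D)"
  have "card {j \<in> J. d j \<le> card X + card J} \<le> card J" using finJ by (intro card_mono) auto
  then have "R (card X + card J)" by (simp add: R_def)
  then have D_le: "D \<le> card X + card J" and RD: "R D"
    unfolding D_def by (auto intro: Least_le LeastI)
  have D_upper: "D \<le> card X + card {j \<in> J. d j \<le> D}"
  proof (cases D)
    case (Suc D')
    have "\<not> R D'" using not_less_Least[of D' R] Suc by (simp add: D_def)
    moreover have "card {j \<in> J. d j \<le> D'} \<le> card {j \<in> J. d j \<le> D}"
      using Suc finJ by (intro card_mono) auto
    ultimately show ?thesis using Suc by (simp add: R_def)
  qed simp
  define F where "F = (\<lambda>x p. poly p x) ` X \<union> (\<lambda>j p. poly ((pderiv ^^ d j) p) (c j)) ` {j \<in> J. d j \<le> D}"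
  have "card F \<le> card ((\<lambda>x p. poly p x) ` X) + card ((\<lambda>j p. poly ((pderiv ^^ d j) p) (c j)) ` {j \<in> J. d j \<le> D})"
    unfolding F_def by (rule card_Un_le)
  also have "\<dots> \<le> card X + card {j \<in> J. d j \<le> D}"
    using X finJ by (intro add_mono card_image_le) auto
  also have "\<dots> \<le> D" using RD by (simp add: R_def)
  finally have "card F < card {..D}" by simp
  then have "\<exists>q. q \<noteq> 0 \<and> degree q \<in> {..D} \<and> (\<forall>f\<in>F. f q = 0) \<and>
           (\<forall>f. linfun f \<longrightarrow> (\<forall>i\<in>{..D}. f (monom 1 i) = 0) \<longrightarrow> f q = 0)"
    using X finJ
    by (intro exists_poly_killed_by_functionals)
      (auto simp: F_def linfun_poly linfun_poly_higher_pderiv degree_monom_eq)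
  then obtain Q where Q: "Q \<noteq> 0" "degree Q \<le> D" "\<And>f. f \<in> F \<Longrightarrow> f Q = 0" by auto
  have QX: "poly Q x = 0" if "x \<in> X" for x
    using Q(3)[of "\<lambda>p. poly p x"] that by (auto simp: F_def)
  have QJ: "poly ((pderiv ^^ d j) Q) (c j) = 0" if "j \<in> J" for j
  proof (cases "d j \<le> D")
    case True
    then show ?thesis using Q(3)[of "\<lambda>p. poly ((pderiv ^^ d j) p) (c j)"] that by (auto simp: F_def)
  next
    case False
    then have "(pderiv ^^ d j) Q = 0"
      using Q(2) by (intro poly_eqI) (auto simp: coeff_higher_pderiv intro!: coeff_eq_0)
    then show ?thesis by simp
  qed
  have count: "zeros_in Q {-1<..<1} + card {j \<in> J. d j \<le> degree Q} \<le> degree Q"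
    using zeros_plus_constraints_le_degree[OF nest Q(1) QJ] .
  have "card X \<le> (\<Sum>x\<in>X. order x Q)"
    using QX Q(1) by (subst card_eq_sum, intro sum_mono) (auto simp: order_root Suc_le_eq)
  also have sumX: "\<dots> \<le> zeros_in Q {-1<..<1}"
    using Q(1) X by (intro sum_order_le_zeros_in)
  finally have "R (degree Q)" using count by (simp add: R_def)
  then have "degree Q = D" using Q(2) Least_le[of R "degree Q"] by (simp add: D_def)
  then have zX: "zeros_in Q {-1<..<1} \<le> card X" using count D_upper by simp
  have "order x Q = (if x \<in> X then 1 else 0)" if x: "x \<in> {-1<..<1}" for x
  proof -
    have ge: "card (X - {x}) \<le> (\<Sum>y\<in>X - {x}. order y Q)"
      using QX Q(1) by (subst card_eq_sum, intro sum_mono) (auto simp: order_root Suc_le_eq)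
    have "(\<Sum>y\<in>insert x X. order y Q) \<le> zeros_in Q {-1<..<1}"
      using Q(1) X x by (intro sum_order_le_zeros_in) auto
    then have "order x Q + card (X - {x}) \<le> card X"
      using zX ge X by (simp add: sum.insert_remove)
    moreover have "x \<in> X \<Longrightarrow> order x Q \<noteq> 0" using QX Q(1) by (auto simp: order_root)
    moreover have "x \<in> X \<Longrightarrow> card X = Suc (card (X - {x}))" using X by (metis card_Suc_Diff1)
    ultimately show ?thesis by auto
  qed
  with Q QJ D_le show ?thesis by (intro exI[of _ Q]) auto
qed

section \<open>Zeros in the interval of an orthogonal polynomial\<close>
lemma even_orders_imp_constant_sign:
  fixes p :: "real poly"
  assumes "p \<noteq> 0" "\<And>x. x \<in> {a<..<b} \<Longrightarrow> even (order x p)"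
  shows "(\<forall>x\<in>{a<..<b}. 0 \<le> poly p x) \<or> (\<forall>x\<in>{a<..<b}. poly p x \<le> 0)"
  using assms
proof (induction "degree p" arbitrary: p rule: less_induct)
  case less
  show ?case
  proof (cases "\<exists>z\<in>{a<..<b}. poly p z = 0")
    case True
    then obtain z where z: "z \<in> {a<..<b}" "poly p z = 0" by blast
    have "order z p \<noteq> 0" "even (order z p)" using z less.prems by (auto simp: order_root)
    then have "2 \<le> order z p" by presburger
    then have "[:-z, 1:]^2 dvd p" by (metis order_1 le_imp_power_dvd dvd_trans)
    then obtain q where q: "p = [:-z, 1:]^2 * q" by (auto elim: dvdE)
    have q0: "q \<noteq> 0" using q less.prems by auto
    have "degree p = 2 + degree q" using q0 unfolding q by (simp add: degree_mult_eq degree_power_eq)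
    moreover have "even (order x q)" if "x \<in> {a<..<b}" for x
    proof -
      have "order x p = order x ([:-z, 1:]^2) + order x q"
        using less.prems(1) unfolding q by (rule order_mult)
      moreover have "even (order x ([:-z, 1:]^2))"
        by (cases "x = z") (simp_all add: order_power_n_n order_0I)
      ultimately show ?thesis using less.prems(2)[OF that] by simp
    qed
    ultimately have "(\<forall>x\<in>{a<..<b}. 0 \<le> poly q x) \<or> (\<forall>x\<in>{a<..<b}. poly q x \<le> 0)"
      using q0 by (intro less.hyps) auto
    moreover have "poly p x = (x - z)^2 * poly q x" for x unfolding q by simp
    ultimately show ?thesis by (auto simp: mult_nonneg_nonpos)
  next
    case False
    show ?thesis
    proof (rule ccontr)
      assume "\<not> ?thesis"
      then obtain x y where xy: "x \<in> {a<..<b}" "y \<in> {a<..<b}" "poly p x < 0" "poly p y > 0"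
        by (auto simp: not_le)
      then consider "x < y" | "y < x" by fastforce
      then show False
      proof cases
        case 1
        then show False using poly_IVT_pos[OF 1] xy False by force
      next
        case 2
        then show False using poly_IVT_neg[OF 2] xy False by force
      qed
    qed
  qed
qed

text \<open>
  An abstraction of integration over \<open>[-1, 1]\<close> against a measure with infinite support.
\<close>
locale positive_functional =
  fixes L :: "real poly \<Rightarrow> real"
  assumes linear: "linfun L"
    and pos: "\<lbrakk>p \<noteq> 0; \<And>x. x \<in> {-1<..<1} \<Longrightarrow> 0 \<le> poly p x\<rbrakk> \<Longrightarrow> 0 < L p"
begin

lemma nonneg: "(\<And>x. x \<in> {-1<..<1} \<Longrightarrow> 0 \<le> poly p x) \<Longrightarrow> 0 \<le> L p"
  using pos[of p] linfun_0[OF linear] by (cases "p = 0") auto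

lemma nonzero_if_even_orders:
  assumes "p \<noteq> 0" "\<And>x. x \<in> {-1<..<1} \<Longrightarrow> even (order x p)"
  shows "L p \<noteq> 0"
proof -
  consider "\<forall>x\<in>{-1<..<1}. 0 \<le> poly p x" | "\<forall>x\<in>{-1<..<1}. poly p x \<le> 0"
    using even_orders_imp_constant_sign[OF assms] by blast
  then show ?thesis
  proof cases
    case 1
    then show ?thesis using pos[of p] assms by force
  next
    case 2
    then have "0 < L (smult (-1) p)" using assms by (intro pos) auto
    then show ?thesis unfolding linfun_smult[OF linear] by simp
  qed
qed

text \<open>
  The zeros are those of odd order. For \<open>J = {}\<close> this is the classical fact that an orthogonal polynomial
  of degree \<open>n\<close> has \<open>n\<close> simple zeros in the interval of orthogonality.
\<close>
lemma exists_zeros_inside: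
  assumes nest: "nested_constraints J c d" and S: "S \<noteq> 0"
    and orth: "\<And>q. degree q < n \<Longrightarrow> (\<And>j. j \<in> J \<Longrightarrow> poly ((pderiv ^^ d j) q) (c j) = 0) \<Longrightarrow> L (q * S) = 0"
  shows "\<exists>X. finite X \<and> X \<subseteq> {-1<..<1} \<and> (\<forall>x\<in>X. poly S x = 0) \<and> n \<le> card X + card J"
proof -
  define X where "X = {x \<in> {-1<..<1}. odd (order x S)}"
  have roots: "poly S x = 0" if "x \<in> X" for x
    using that by (auto simp: X_def order_root intro!: Nat.gr0I)
  then have X: "finite X" "X \<subseteq> {-1<..<1}"
    using finite_subset[OF _ poly_roots_finite[OF S], of X] by (auto simp: X_def)
  obtain Q where Q: "Q \<noteq> 0" "degree Q \<le> card X + card J"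
    "\<And>j. j \<in> J \<Longrightarrow> poly ((pderiv ^^ d j) Q) (c j) = 0"
    "\<And>x. x \<in> {-1<..<1} \<Longrightarrow> order x Q = (if x \<in> X then 1 else 0)"
    using exists_poly_with_exact_zeros[OF nest X] by blast
  have "n \<le> card X + card J"
  proof (rule ccontr)
    assume "\<not> ?thesis"
    then have "L (Q * S) = 0" using Q by (intro orth) auto
    moreover have "L (Q * S) \<noteq> 0"
      using Q(1,4) S by (intro nonzero_if_even_orders) (auto simp: order_mult X_def)
    ultimately show False by simp
  qed
  with X roots show ?thesis by blast
qed

end

section \<open>Interlacing and growth via Gauss quadrature\<close>
lemma monic_eq_prod_roots:
  fixes P :: "real poly"
  assumes "lead_coeff P = 1" "finite X" "card X = degree P" "\<And>x. x \<in> X \<Longrightarrow> poly P x = 0"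
  shows "P = (\<Prod>x\<in>X. [:-x, 1:])"
proof (rule poly_eqI_degree_lead_coeff[where A = X and n = "degree P"])
  have "degree (\<Prod>x\<in>X. [:-x, 1:]) = degree P"
    using assms(3) by (subst degree_prod_eq_sum_degree) auto
  then show "degree (\<Prod>x\<in>X. [:-x, 1:]) \<le> degree P"
    and "coeff P (degree P) = coeff (\<Prod>x\<in>X. [:-x, 1:]) (degree P)"
    using assms(1) lead_coeff_prod[of "\<lambda>x. [:-x, 1::real:]" X] by simp_all
qed (use assms in \<open>auto simp: poly_prod\<close>)

text \<open>
  Walking through \<open>X\<close> from left to right, a zero of \<open>F\<close> is collected whenever the sign changes, together
  with the neighbours \<open>pr y\<close> and \<open>su y\<close> that enclose it. The polynomial with exactly the collected
  zeros then changes sign along \<open>X\<close> in the same places as \<open>F\<close>; the factor \<open>\<sigma>\<close> is the common sign of the product.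
\<close>
lemma exists_zeros_at_sign_changes:
  fixes F :: "real poly"
  assumes "finite X" "X \<noteq> {}" "\<And>x. x \<in> X \<Longrightarrow> poly F x \<noteq> 0"
  shows "\<exists>Y pr su \<sigma>. finite Y \<and> inj_on pr Y \<and> inj_on su Y \<and>
     (\<forall>y\<in>Y. poly F y = 0 \<and> pr y \<in> X \<and> su y \<in> X \<and> pr y < y \<and> y < su y) \<and>
     (\<forall>x\<in>X. 0 < \<sigma> * (\<Prod>y\<in>Y. x - y) * poly F x)"
  using assms
proof (induction X rule: finite_linorder_max_induct)
  case empty
  then show ?case by simp
next
  case (insert b A)
  show ?case
  proof (cases "A = {}")
    case True
    have "0 < poly F b * poly F b" using insert.prems(2)[of b] by (auto simp: zero_less_mult_iff linorder_neq_iff)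
    with True show ?thesis by (intro exI[of _ "{}"] exI[of _ id] exI[of _ "poly F b"]) auto
  next
    case False
    then obtain Y pr su \<sigma> where Y: "finite Y" "inj_on pr Y" "inj_on su Y"
      "\<And>y. y \<in> Y \<Longrightarrow> poly F y = 0 \<and> pr y \<in> A \<and> su y \<in> A \<and> pr y < y \<and> y < su y"
      "\<And>x. x \<in> A \<Longrightarrow> 0 < \<sigma> * (\<Prod>y\<in>Y. x - y) * poly F x"
      using insert by (metis insert_iff)
    have M: "Max A \<in> A" "Max A < b" using False insert by auto
    have suM: "su y \<le> Max A" if "y \<in> Y" for y using Y(4)[OF that] insert.hyps by simp
    have lt: "y < Max A" if "y \<in> Y" for y using Y(4)[OF that] suM[OF that] by simp
    have posM: "0 < (\<Prod>y\<in>Y. Max A - y)" using lt by (intro prod_pos) auto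
    have posb: "0 < (\<Prod>y\<in>Y. b - y)" using lt M by (intro prod_pos) force
    have sM: "0 < \<sigma> * poly F (Max A)"
      using Y(5)[OF M(1)] posM by (auto simp: zero_less_mult_iff mult_less_0_iff)
    show ?thesis
    proof (cases "0 < \<sigma> * poly F b")
      case True
      then have "0 < \<sigma> * (\<Prod>y\<in>Y. b - y) * poly F b"
        using posb by (auto simp: zero_less_mult_iff mult_less_0_iff)
      with Y show ?thesis
        by (intro exI[of _ Y] exI[of _ pr] exI[of _ su] exI[of _ \<sigma>]) auto
    next
      case False
      then have sb: "\<sigma> * poly F b < 0" using sM insert.prems(2)[of b] by (auto simp: not_less_iff_gr_or_eq)
      then have "poly F (Max A) * poly F b < 0"
        using sM by (auto simp: zero_less_mult_iff mult_less_0_iff)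
      then obtain t where t: "Max A < t" "t < b" "poly F t = 0"
        using poly_IVT[OF M(2)] by blast
      define pr' where "pr' = pr(t := Max A)"
      define su' where "su' = su(t := b)"
      have tY: "t \<notin> Y" using lt t by force
      have prsu: "pr' y = pr y" "su' y = su y" if "y \<in> Y" for y
        using that tY by (auto simp: pr'_def su'_def)
      have "inj_on pr' Y" "inj_on su' Y"
        using Y(2,3) prsu by (simp_all cong: inj_on_cong)
      moreover have "pr' t \<notin> pr' ` Y"
        using Y(4) lt prsu tY unfolding pr'_def by (force simp: pr'_def)
      moreover have "su' t \<notin> su' ` Y"
        using suM M prsu tY unfolding su'_def by (force simp: su'_def)
      ultimately have "inj_on pr' (insert t Y)" "inj_on su' (insert t Y)"
        using tY by simp_all
      moreover have "poly F y = 0 \<and> pr' y \<in> insert b A \<and> su' y \<in> insert b A \<and> pr' y < y \<and> y < su' y"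
        if "y \<in> insert t Y" for y
        using that
      proof
        assume "y = t"
        then show ?thesis using t M by (simp add: pr'_def su'_def)
      next
        assume "y \<in> Y"
        then show ?thesis using Y(4) prsu by simp
      qed
      moreover have "0 < - \<sigma> * (\<Prod>y\<in>insert t Y. x - y) * poly F x" if "x \<in> insert b A" for x
        using that
      proof
        assume "x = b"
        have "0 < (t - b) * (\<Prod>y\<in>Y. b - y) * (\<sigma> * poly F b)"
          using mult_neg_neg[OF mult_neg_pos[OF _ posb] sb, of "t - b"] t by simp
        then show ?thesis using Y(1) tY \<open>x = b\<close> by (simp add: algebra_simps)
      next
        assume "x \<in> A"
        then have "x < t" using t insert.hyps by (meson Max_ge le_less_trans)
        then have "0 < (t - x) * (\<sigma> * (\<Prod>y\<in>Y. x - y) * poly F x)"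
          using Y(5)[OF \<open>x \<in> A\<close>] by (intro mult_pos_pos[of "t - x"]) auto
        then show ?thesis using Y(1) tY by (simp add: algebra_simps)
      qed
      ultimately show ?thesis using Y(1)
        by (intro exI[of _ "insert t Y"] exI[of _ pr'] exI[of _ su'] exI[of _ "- \<sigma>"]) auto
    qed
  qed
qed

text \<open>
  Moving a point \<open>y\<close> to its neighbour in \<open>X\<close> on the side of \<open>c\<close> decreases its distance from \<open>c\<close>, and the at most
  \<open>m\<close> points of \<open>X\<close> not used in this way have distance at most \<open>\<bar>c\<bar> + 1\<close>.
\<close>
lemma prod_dist_le_of_interlacing:
  fixes c :: real
  assumes c: "1 < \<bar>c\<bar>" and X: "finite X" "X \<subseteq> {-1<..<1}"
    and Y: "finite Y" "inj_on pr Y" "inj_on su Y"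
      "\<And>y. y \<in> Y \<Longrightarrow> pr y \<in> X \<and> su y \<in> X \<and> pr y < y \<and> y < su y"
    and m: "card X \<le> card Y + m"
  shows "(\<Prod>x\<in>X. \<bar>c - x\<bar>) \<le> (\<bar>c\<bar> + 1) ^ m * (\<Prod>y\<in>Y. \<bar>c - y\<bar>)"
proof -
  \<comment> \<open>The neighbour that lies closer to \<open>c\<close>.\<close>
  define g where "g = (if 0 < c then su else pr)"
  have g: "inj_on g Y" "g ` Y \<subseteq> X" using Y by (auto simp: g_def)
  have dist: "\<bar>c - g y\<bar> \<le> \<bar>c - y\<bar>" if "y \<in> Y" for y
  proof -
    have "pr y \<in> {-1<..<1}" "su y \<in> {-1<..<1}" using Y(4)[OF that] X by auto
    then show ?thesis using Y(4)[OF that] c by (auto simp: g_def)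
  qed
  have "(\<Prod>x\<in>X. \<bar>c - x\<bar>) = (\<Prod>x\<in>X - g ` Y. \<bar>c - x\<bar>) * (\<Prod>x\<in>g ` Y. \<bar>c - x\<bar>)"
    using g X by (intro prod.subset_diff) auto
  also have "\<dots> \<le> (\<bar>c\<bar> + 1) ^ m * (\<Prod>y\<in>Y. \<bar>c - y\<bar>)"
  proof (rule mult_mono)
    have "card (X - g ` Y) = card X - card Y"
      using g X Y by (simp add: card_Diff_subset finite_subset card_image)
    then have "card (X - g ` Y) \<le> m" using m by simp
    have "(\<Prod>x\<in>X - g ` Y. \<bar>c - x\<bar>) \<le> (\<Prod>x\<in>X - g ` Y. \<bar>c\<bar> + 1)"
      using X by (intro prod_mono) fastforce
    also have "\<dots> \<le> (\<bar>c\<bar> + 1) ^ m"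
      using \<open>card (X - g ` Y) \<le> m\<close> by (simp add: power_increasing)
    finally show "(\<Prod>x\<in>X - g ` Y. \<bar>c - x\<bar>) \<le> (\<bar>c\<bar> + 1) ^ m" .
    show "(\<Prod>x\<in>g ` Y. \<bar>c - x\<bar>) \<le> (\<Prod>y\<in>Y. \<bar>c - y\<bar>)"
      using g dist by (simp add: prod.reindex) (intro prod_mono, auto)
  qed (auto intro: prod_nonneg)
  finally show ?thesis .
qed

context positive_functional
begin

definition orthogonal_monic :: "real poly \<Rightarrow> nat \<Rightarrow> bool" where
  "orthogonal_monic P n \<longleftrightarrow>
     degree P = n \<and> lead_coeff P = 1 \<and> (\<forall>q. degree q < n \<longrightarrow> L (q * P) = 0)"

lemma orthogonal_monic_eq_prod:
  assumes "orthogonal_monic P n"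
  shows "\<exists>X. finite X \<and> card X = n \<and> X \<subseteq> {-1<..<1} \<and> P = (\<Prod>x\<in>X. [:-x, 1:])"
proof -
  have P: "degree P = n" "lead_coeff P = 1" "\<And>q. degree q < n \<Longrightarrow> L (q * P) = 0"
    using assms by (auto simp: orthogonal_monic_def)
  have P0: "P \<noteq> 0" using P(2) by auto
  obtain X where X: "finite X" "X \<subseteq> {-1<..<1}" "\<forall>x\<in>X. poly P x = 0" "n \<le> card X"
    using exists_zeros_inside[of "{} :: unit set" undefined undefined P n] P P0
    by (auto simp: nested_constraints_def)
  have "card X \<le> n"
  proof -
    have "card X \<le> card {x. poly P x = 0}"
      using X(3) by (intro card_mono poly_roots_finite[OF P0]) auto
    also have "\<dots> \<le> n" using card_poly_roots_bound[OF P0] P(1) by simp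
    finally show ?thesis .
  qed
  with X P show ?thesis
    by (intro exI[of _ X]) (auto intro!: monic_eq_prod_roots)
qed

text \<open>
  Modulo \<open>P\<close> every \<open>f\<close> of degree less than \<open>2 n\<close> reduces to its Lagrange interpolant at the zeros of \<open>P\<close>
  without changing \<open>L f\<close>. Applied to the square of a Lagrange basis polynomial \<open>l x\<close>
  this gives \<open>L (l x) = L (l x * l x)\<close>, so the weights are positive.
\<close>
lemma gauss_quadrature:
  assumes "orthogonal_monic P n"
  shows "\<exists>X w. finite X \<and> card X = n \<and> X \<subseteq> {-1<..<1} \<and> P = (\<Prod>x\<in>X. [:-x, 1:]) \<and>
           (\<forall>x\<in>X. 0 < w x) \<and> (\<forall>f. degree f < 2 * n \<longrightarrow> L f = (\<Sum>x\<in>X. w x * poly f x))"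
proof -
  have P: "degree P = n" "lead_coeff P = 1" "\<And>q. degree q < n \<Longrightarrow> L (q * P) = 0"
    using assms by (auto simp: orthogonal_monic_def)
  have P0: "P \<noteq> 0" using P(2) by auto
  obtain X where X: "finite X" "card X = n" "X \<subseteq> {-1<..<1}" and PX: "P = (\<Prod>x\<in>X. [:-x, 1:])"
    using orthogonal_monic_eq_prod[OF assms] by blast
  define l where "l x = smult (1 / (\<Prod>y\<in>X - {x}. x - y)) (\<Prod>y\<in>X - {x}. [:-y, 1:])" for x :: real
  have l: "poly (l x) y = (if y = x then 1 else 0)" if "x \<in> X" "y \<in> X" for x y
    using that X(1) by (auto simp: l_def poly_prod)
  have deg_l: "degree (l x) < n" if "x \<in> X" for x
  proof -
    have "degree (l x) \<le> degree (\<Prod>y\<in>X - {x}. [:-y, 1:])" unfolding l_def by (rule degree_smult_le)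
    also have "\<dots> = card (X - {x})" by (subst degree_prod_eq_sum_degree) auto
    also have "\<dots> < n" using that X by (metis card_Diff1_less)
    finally show ?thesis .
  qed
  have small: "L f = (\<Sum>x\<in>X. L (l x) * poly f x)" if "degree f < n" for f
  proof -
    have "degree (\<Sum>x\<in>X. smult (poly f x) (l x)) < n"
      using deg_l that by (intro degree_sum_less) (auto intro: le_less_trans[OF degree_smult_le])
    then have "f = (\<Sum>x\<in>X. smult (poly f x) (l x))"
    proof (intro poly_eqI_degree[where A = X])
      show "poly f y = poly (\<Sum>x\<in>X. smult (poly f x) (l x)) y" if "y \<in> X" for y
      proof -
        have "poly (\<Sum>x\<in>X. smult (poly f x) (l x)) y = (\<Sum>x\<in>X. if x = y then poly f x else 0)"
          unfolding poly_sum using that l by (intro sum.cong) auto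
        then show ?thesis using that X(1) by (simp add: sum.delta)
      qed
    qed (use that X in auto)
    then have "L f = L (\<Sum>x\<in>X. smult (poly f x) (l x))" by simp
    also have "\<dots> = (\<Sum>x\<in>X. L (l x) * poly f x)"
      by (simp add: linfun_sum[OF linear] linfun_smult[OF linear] mult.commute)
    finally show ?thesis .
  qed
  have exact: "L f = (\<Sum>x\<in>X. L (l x) * poly f x)" if "degree f < 2 * n" for f
  proof -
    have n: "0 < n" using that by simp
    have "degree (f div P) < n"
    proof (cases "f div P = 0")
      case False
      have "degree (f div P) + n = degree (f - f mod P)"
        using False P0 P(1) by (simp add: minus_mod_eq_div_mult degree_mult_eq)
      also have "degree (f mod P) < 2 * n"
        using n P(1) degree_mod_less'[OF P0, of f] by (cases "f mod P = 0") simp_all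
      then have "degree (f - f mod P) < 2 * n" using that by (intro degree_diff_less)
      finally show ?thesis by simp
    qed (use n in simp)
    have "L f = L (f div P * P) + L (f mod P)"
      using linfun_add[OF linear, of "f div P * P" "f mod P"] by simp
    also have "L (f div P * P) = 0" using \<open>degree (f div P) < n\<close> P(3) by simp
    also have "0 + L (f mod P) = (\<Sum>x\<in>X. L (l x) * poly (f mod P) x)"
      using degree_mod_less'[OF P0, of f] P(1) n by (cases "f mod P = 0") (simp_all add: small)
    also have "\<dots> = (\<Sum>x\<in>X. L (l x) * poly f x)"
    proof (intro sum.cong refl)
      fix x assume "x \<in> X"
      then have "poly P x = 0" using X(1) by (auto simp: PX poly_prod)
      moreover have "poly f x = poly (f div P) x * poly P x + poly (f mod P) x"
        unfolding poly_mult[symmetric] poly_add[symmetric] by simp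
      ultimately show "L (l x) * poly (f mod P) x = L (l x) * poly f x" by simp
    qed
    finally show ?thesis .
  qed
  have "0 < L (l x)" if x: "x \<in> X" for x
  proof -
    have "l x \<noteq> 0" using l[OF x x] by auto
    then have "0 < L (l x * l x)" by (intro pos) auto
    also have "degree (l x * l x) < 2 * n" using deg_l[OF x] degree_mult_le[of "l x" "l x"] by simp
    then have "L (l x * l x) = (\<Sum>y\<in>X. L (l y) * (poly (l x) y * poly (l x) y))"
      by (simp add: exact)
    also have "\<dots> = (\<Sum>y\<in>X. if y = x then L (l y) else 0)"
      using l[OF x] by (intro sum.cong) auto
    also have "\<dots> = L (l x)" using x X by (simp add: sum.delta)
    finally show ?thesis .
  qed
  with X PX exact show ?thesis by (intro exI[of _ X] exI[of _ "\<lambda>x. L (l x)"]) simp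
qed

text \<open>
  The polynomial \<open>B = (c\<^sup>n P - P(c) x\<^sup>n) / (x - c)\<close> has degree less than \<open>n\<close>, hence \<open>L (B * P) = 0\<close>, that is,
  \<open>c\<^sup>n \<integral> P\<^sup>2 / (x - c) = P(c) \<integral> P x\<^sup>n / (x - c)\<close>. On the left \<open>x - c\<close> has constant sign and is bounded,
  and on the right \<open>\<bar>x\<^sup>n / (x - c)\<bar> \<le> 1 / (\<bar>c\<bar> - 1)\<close>. The functional \<open>L\<close> is defined on polynomials only, so
  these integrals are expressed by the quadrature formula with \<open>n + 1\<close> nodes, which is exact for \<open>P\<^sup>2\<close>. The nodes
  are the zeros of \<open>P'\<close>, the orthogonal polynomial of the next degree.
\<close>
lemma orthogonal_monic_growth:
  assumes c: "1 < \<bar>c\<bar>" and P: "orthogonal_monic P n" and P': "orthogonal_monic P' (Suc n)"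
  shows "\<bar>c\<bar> ^ n * sqrt (L (P * P)) * (2 * (\<bar>c\<bar> - 1)) \<le> \<bar>poly P c\<bar> * ((\<bar>c\<bar> + 1) * (1 + L 1))"
proof -
  have dP: "degree P = n" "lead_coeff P = 1" "\<And>q. degree q < n \<Longrightarrow> L (q * P) = 0"
    using P by (auto simp: orthogonal_monic_def)
  have P0: "P \<noteq> 0" using dP(2) by auto
  obtain X w where X: "finite X" "X \<subseteq> {-1<..<1}" and w: "\<And>x. x \<in> X \<Longrightarrow> 0 < w x"
    and gauss: "\<And>f. degree f < 2 * Suc n \<Longrightarrow> L f = (\<Sum>x\<in>X. w x * poly f x)"
    using gauss_quadrature[OF P'] by blast
  define \<tau> where "\<tau> = L (P * P)"
  define s where "s = sqrt \<tau>"
  have \<tau>: "0 < \<tau>" unfolding \<tau>_def using P0 by (intro pos) auto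
  then have s: "0 < s" "s * s = \<tau>" by (simp_all add: s_def)
  have "degree (P * P) = 2 * n" using dP(1) P0 by (simp add: degree_mult_eq)
  then have sumPP: "(\<Sum>x\<in>X. w x * (poly P x * poly P x)) = \<tau>"
    using gauss[of "P * P"] by (simp add: \<tau>_def)
  have sum1: "(\<Sum>x\<in>X. w x) = L 1" using gauss[of 1] by simp
  have "[:-c, 1:] dvd smult (c ^ n) P - smult (poly P c) (monom 1 n)"
    by (simp add: dvd_iff_poly_eq_0 poly_monom)
  then obtain B where B: "smult (c ^ n) P - smult (poly P c) (monom 1 n) = [:-c, 1:] * B"
    by (elim dvdE)
  have "degree (smult (c ^ n) P - smult (poly P c) (monom 1 n)) \<le> n"
    using dP(1) degree_monom_le[of "1::real" n] by (intro degree_diff_le) (auto intro: order_trans[OF degree_smult_le])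
  then have degB: "B = 0 \<or> degree B < n" unfolding B by (cases "B = 0") (simp_all add: degree_mult_eq del: mult_pCons_left)
  then have "L (B * P) = 0" using dP(3) linfun_0[OF linear] by auto
  moreover have "degree (B * P) < 2 * Suc n" using degB dP(1) degree_mult_le[of B P] by auto
  ultimately have "(\<Sum>x\<in>X. w x * poly (B * P) x) = 0" using gauss by metis
  also have "(\<Sum>x\<in>X. w x * poly (B * P) x) =
     (\<Sum>x\<in>X. c ^ n * (w x * (poly P x * poly P x)) / (x - c) - poly P c * (w x * poly P x * x ^ n / (x - c)))"
  proof (intro sum.cong refl)
    fix x assume "x \<in> X"
    then have "x - c \<noteq> 0" using X(2) c by force
    have "poly (smult (c ^ n) P - smult (poly P c) (monom 1 n)) x = (x - c) * poly B x"
      unfolding B by (simp add: algebra_simps)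
    then have "poly B x = (c ^ n * poly P x - poly P c * x ^ n) / (x - c)"
      using \<open>x - c \<noteq> 0\<close> by (simp add: poly_monom field_simps)
    then have "w x * poly (B * P) x = w x * poly P x * ((c ^ n * poly P x - poly P c * x ^ n) / (x - c))"
      by simp
    also have "\<dots> = (c ^ n * (w x * (poly P x * poly P x)) - poly P c * (w x * poly P x * x ^ n)) / (x - c)"
      by (simp add: algebra_simps)
    finally show "w x * poly (B * P) x =
      c ^ n * (w x * (poly P x * poly P x)) / (x - c) - poly P c * (w x * poly P x * x ^ n / (x - c))"
      by (simp add: diff_divide_distrib)
  qed
  finally have key: "c ^ n * (\<Sum>x\<in>X. w x * (poly P x * poly P x) / (x - c))
     = poly P c * (\<Sum>x\<in>X. w x * poly P x * x ^ n / (x - c))"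
    by (simp add: sum_subtractf sum_distrib_left)
  have near: "\<bar>c\<bar> - 1 \<le> \<bar>x - c\<bar>" "\<bar>x - c\<bar> \<le> \<bar>c\<bar> + 1" "0 < \<bar>x - c\<bar>" "\<bar>x\<bar> \<le> 1"
    "x - c = - sgn c * \<bar>x - c\<bar>" if "x \<in> X" for x
  proof -
    have "-1 < x" "x < 1" using that X(2) by auto
    then show "\<bar>c\<bar> - 1 \<le> \<bar>x - c\<bar>" "\<bar>x - c\<bar> \<le> \<bar>c\<bar> + 1" "0 < \<bar>x - c\<bar>" "\<bar>x\<bar> \<le> 1"
      "x - c = - sgn c * \<bar>x - c\<bar>"
      using c by (auto simp: sgn_if)
  qed
  have "(\<Sum>x\<in>X. w x * (poly P x * poly P x) / (x - c))
      = (\<Sum>x\<in>X. - sgn c * (w x * (poly P x * poly P x) / \<bar>x - c\<bar>))"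
  proof (intro sum.cong refl)
    fix x assume "x \<in> X"
    have "1 / (x - c) = - sgn c / \<bar>x - c\<bar>"
      using near(3,5)[OF \<open>x \<in> X\<close>] c by (auto simp: sgn_if divide_simps)
    then show "w x * (poly P x * poly P x) / (x - c) = - sgn c * (w x * (poly P x * poly P x) / \<bar>x - c\<bar>)"
      by (metis (no_types, opaque_lifting) mult.commute mult.right_neutral times_divide_eq_right)
  qed
  also have "\<dots> = - sgn c * (\<Sum>x\<in>X. w x * (poly P x * poly P x) / \<bar>x - c\<bar>)"
    by (simp add: sum_distrib_left)
  finally have abs1: "\<bar>\<Sum>x\<in>X. w x * (poly P x * poly P x) / (x - c)\<bar> =
      \<bar>\<Sum>x\<in>X. w x * (poly P x * poly P x) / \<bar>x - c\<bar>\<bar>"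
    using c by (cases "c = 0") (simp_all add: abs_mult abs_sgn_eq)
  have "\<tau> / (\<bar>c\<bar> + 1) = (\<Sum>x\<in>X. w x * (poly P x * poly P x) / (\<bar>c\<bar> + 1))"
    by (simp add: sumPP[symmetric] sum_divide_distrib)
  also have "\<dots> \<le> (\<Sum>x\<in>X. w x * (poly P x * poly P x) / \<bar>x - c\<bar>)"
  proof (intro sum_mono divide_left_mono)
    fix x assume x: "x \<in> X"
    show "0 \<le> w x * (poly P x * poly P x)" using w[OF x] by simp
    show "\<bar>x - c\<bar> \<le> \<bar>c\<bar> + 1" by (rule near(2)[OF x])
    show "0 < (\<bar>c\<bar> + 1) * \<bar>x - c\<bar>" using near(3)[OF x] by (intro mult_pos_pos) auto
  qed
  finally have "\<tau> / (\<bar>c\<bar> + 1) \<le> \<bar>\<Sum>x\<in>X. w x * (poly P x * poly P x) / (x - c)\<bar>"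
    unfolding abs1 by simp
  then have "\<bar>c\<bar> ^ n * (\<tau> / (\<bar>c\<bar> + 1)) \<le> \<bar>c ^ n * (\<Sum>x\<in>X. w x * (poly P x * poly P x) / (x - c))\<bar>"
    unfolding abs_mult power_abs by (intro mult_left_mono) auto
  also have "\<dots> = \<bar>poly P c\<bar> * \<bar>\<Sum>x\<in>X. w x * poly P x * x ^ n / (x - c)\<bar>"
    unfolding key by (simp add: abs_mult)
  also have "\<bar>\<Sum>x\<in>X. w x * poly P x * x ^ n / (x - c)\<bar> \<le> (\<Sum>x\<in>X. \<bar>w x * poly P x * x ^ n / (x - c)\<bar>)"
    by (rule sum_abs)
  also have "\<dots> \<le> (\<Sum>x\<in>X. w x * ((poly P x * poly P x / s + s) / 2) / (\<bar>c\<bar> - 1))"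
  proof (rule sum_mono)
    fix x assume x: "x \<in> X"
    \<comment> \<open>With \<open>s\<close> the norm of \<open>P\<close>, this replaces the Cauchy-Schwarz inequality for the sum of \<open>w x * \<bar>poly P x\<bar>\<close>.\<close>
    have "0 \<le> (\<bar>poly P x\<bar> - s)\<^sup>2" by simp
    then have "\<bar>poly P x\<bar> * (2 * s) \<le> poly P x * poly P x + s * s"
      by (simp add: power2_eq_square algebra_simps)
    then have am: "\<bar>poly P x\<bar> \<le> (poly P x * poly P x / s + s) / 2"
      using s(1) by (simp add: field_simps)
    have "\<bar>w x * poly P x * x ^ n / (x - c)\<bar> = w x * \<bar>poly P x\<bar> * \<bar>x\<bar> ^ n / \<bar>x - c\<bar>"
      using w[OF x] by (simp add: abs_mult power_abs)
    also have "\<dots> \<le> w x * \<bar>poly P x\<bar> * 1 / (\<bar>c\<bar> - 1)"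
      using w[OF x] near[OF x] c by (intro frac_le mult_left_mono power_le_one) auto
    also have "\<dots> \<le> w x * ((poly P x * poly P x / s + s) / 2) / (\<bar>c\<bar> - 1)"
      unfolding mult_1_right using am w[OF x] c by (intro divide_right_mono mult_left_mono) auto
    finally show "\<bar>w x * poly P x * x ^ n / (x - c)\<bar> \<le> w x * ((poly P x * poly P x / s + s) / 2) / (\<bar>c\<bar> - 1)" .
  qed
  also have "\<dots> = ((\<Sum>x\<in>X. w x * (poly P x * poly P x)) / s + s * (\<Sum>x\<in>X. w x)) / 2 / (\<bar>c\<bar> - 1)"
    by (simp add: sum_divide_distrib sum_distrib_left sum.distrib[symmetric] algebra_simps add_divide_distrib)
  also have "\<dots> = s * (1 + L 1) / 2 / (\<bar>c\<bar> - 1)"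
    unfolding sumPP sum1 s(2)[symmetric] using s(1) by (simp add: algebra_simps)
  finally have "\<bar>c\<bar> ^ n * (s * s / (\<bar>c\<bar> + 1)) \<le> \<bar>poly P c\<bar> * (s * (1 + L 1) / 2 / (\<bar>c\<bar> - 1))"
    by (simp add: mult_left_mono s(2))
  then have "s * (\<bar>c\<bar> ^ n * (s / (\<bar>c\<bar> + 1))) \<le> s * (\<bar>poly P c\<bar> * ((1 + L 1) / 2 / (\<bar>c\<bar> - 1)))"
    by (simp add: mult_ac)
  then have "\<bar>c\<bar> ^ n * (s / (\<bar>c\<bar> + 1)) \<le> \<bar>poly P c\<bar> * ((1 + L 1) / 2 / (\<bar>c\<bar> - 1))"
    using s(1) by (simp only: mult_le_cancel_left_pos)
  then show ?thesis
    using c unfolding s_def \<tau>_def by (simp add: field_simps)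
qed

text \<open>
  Let \<open>F = w * S\<close> and let \<open>q\<close> be the polynomial whose zeros \<open>Y\<close> separate the sign changes of \<open>F\<close> along the
  zeros of \<open>P\<close>. If \<open>Y\<close> had fewer than \<open>n - m\<close> elements, then \<open>L (q * F) = 0\<close> by orthogonality; the quadrature
  formula is exact for \<open>q * F\<close>, however, and all its nonzero terms have the same sign. If \<open>F\<close> vanishes at all
  zeros of \<open>P\<close>, these zeros themselves are the required ones.
\<close>
lemma quasi_orthogonal_zeros:
  assumes P: "orthogonal_monic P n" and S: "degree S = n" "S \<noteq> 0"
    and w: "w \<noteq> 0" "\<And>x. x \<in> {-1<..<1} \<Longrightarrow> poly w x \<noteq> 0" and deg_w: "degree w = m"
    and orth: "\<And>q. degree q + m < n \<Longrightarrow> L (q * (w * S)) = 0"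
    and c: "1 < \<bar>c\<bar>"
  shows "\<exists>Y. finite Y \<and> Y \<subseteq> {-1<..<1} \<and> (\<forall>y\<in>Y. poly S y = 0) \<and> n \<le> card Y + m \<and>
           \<bar>poly P c\<bar> \<le> (\<bar>c\<bar> + 1) ^ m * (\<Prod>y\<in>Y. \<bar>c - y\<bar>)"
proof -
  obtain X v where X: "finite X" "card X = n" "X \<subseteq> {-1<..<1}" and PX: "P = (\<Prod>x\<in>X. [:-x, 1:])"
    and v: "\<And>x. x \<in> X \<Longrightarrow> 0 < v x"
    and gauss: "\<And>f. degree f < 2 * n \<Longrightarrow> L f = (\<Sum>x\<in>X. v x * poly f x)"
    using gauss_quadrature[OF P] by blast
  have Pc: "\<bar>poly P c\<bar> = (\<Prod>x\<in>X. \<bar>c - x\<bar>)" by (simp add: PX poly_prod abs_prod)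
  define F where "F = w * S"
  define X' where "X' = {x \<in> X. poly F x \<noteq> 0}"
  have X'X: "X' \<subseteq> X" "finite X'" using X(1) by (auto simp: X'_def)
  show ?thesis
  proof (cases "X' = {}")
    case True
    then have "\<forall>x\<in>X. poly S x = 0" using w X(3) by (fastforce simp: X'_def F_def)
    moreover have "(\<Prod>x\<in>X. \<bar>c - x\<bar>) \<le> (\<bar>c\<bar> + 1) ^ m * (\<Prod>x\<in>X. \<bar>c - x\<bar>)"
      using mult_right_mono[of 1 "(\<bar>c\<bar> + 1) ^ m" "\<Prod>x\<in>X. \<bar>c - x\<bar>"]
      by (simp add: one_le_power prod_nonneg)
    ultimately show ?thesis using X Pc by (intro exI[of _ X]) auto
  next
    case False
    obtain Y pr su \<sigma> where Y: "finite Y" "inj_on pr Y" "inj_on su Y"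
      "\<And>y. y \<in> Y \<Longrightarrow> poly F y = 0 \<and> pr y \<in> X' \<and> su y \<in> X' \<and> pr y < y \<and> y < su y"
      "\<And>x. x \<in> X' \<Longrightarrow> 0 < \<sigma> * (\<Prod>y\<in>Y. x - y) * poly F x"
    proof -
      have "\<And>x. x \<in> X' \<Longrightarrow> poly F x \<noteq> 0" by (simp add: X'_def)
      from exists_zeros_at_sign_changes[OF X'X(2) False this] show ?thesis
        using that by blast
    qed
    have inside: "Y \<subseteq> {-1<..<1}"
    proof
      fix y assume "y \<in> Y"
      then have "pr y \<in> {-1<..<1}" "su y \<in> {-1<..<1}" "pr y < y" "y < su y" using Y(4) X'X X(3) by blast+
      then show "y \<in> {-1<..<1}" by auto
    qed
    have card: "n \<le> card Y + m"
    proof (rule ccontr)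
      assume less: "\<not> ?thesis"
      define q where "q = (\<Prod>y\<in>Y. [:-y, 1:])"
      have dq: "degree q = card Y" unfolding q_def by (subst degree_prod_eq_sum_degree) auto
      have q: "poly q x = (\<Prod>y\<in>Y. x - y)" for x by (simp add: q_def poly_prod)
      have "L (q * F) = 0" unfolding F_def using less dq by (intro orth) simp
      moreover have "degree (q * F) \<le> card Y + (m + n)"
        unfolding F_def using degree_mult_le[of q "w * S"] degree_mult_le[of w S] dq deg_w S(1) by simp
      then have "L (q * F) = (\<Sum>x\<in>X. v x * poly (q * F) x)" using less by (intro gauss) simp
      ultimately have "0 = \<sigma> * (\<Sum>x\<in>X. v x * poly (q * F) x)" by simp
      also have "\<dots> = (\<Sum>x\<in>X. v x * (\<sigma> * (\<Prod>y\<in>Y. x - y) * poly F x))"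
        unfolding sum_distrib_left by (intro sum.cong) (auto simp: q)
      also have "\<dots> = (\<Sum>x\<in>X'. v x * (\<sigma> * (\<Prod>y\<in>Y. x - y) * poly F x))"
        using X by (intro sum.mono_neutral_right) (auto simp: X'_def)
      also have "\<dots> > 0"
      proof (intro sum_pos)
        show "0 < v x * (\<sigma> * (\<Prod>y\<in>Y. x - y) * poly F x)" if "x \<in> X'" for x
          using that X'X v[of x] Y(5)[OF that] by (intro mult_pos_pos[of "v x"]) auto
      qed (use False X'X in auto)
      finally show False by simp
    qed
    have "poly S y = 0" if "y \<in> Y" for y
      using Y(4)[OF that] w(2)[of y] inside that by (auto simp: F_def)
    moreover have "(\<Prod>x\<in>X. \<bar>c - x\<bar>) \<le> (\<bar>c\<bar> + 1) ^ m * (\<Prod>y\<in>Y. \<bar>c - y\<bar>)"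
      using Y X card c X'X by (intro prod_dist_le_of_interlacing[of c X Y pr su]) auto
    ultimately show ?thesis using Y(1) inside card Pc by (intro exI[of _ Y]) auto
  qed
qed

end

section \<open>Derivatives outside the interval\<close>
abbreviation cpoly :: "real poly \<Rightarrow> complex poly" where
  "cpoly \<equiv> map_poly complex_of_real"

lemma poly_cpoly: "poly (cpoly p) (of_real x) = of_real (poly p x)"
  by (induction p) (auto simp: map_poly_pCons)

lemma poly_cpoly_cnj: "poly (cpoly p) (cnj z) = cnj (poly (cpoly p) z)"
  by (rule poly_cnj_real[symmetric]) (simp add: coeff_map_poly)

lemma cpoly_prod: "cpoly (\<Prod>i\<in>I. f i) = (\<Prod>i\<in>I. cpoly (f i))"
proof -
  have "cpoly (p * q) = cpoly p * cpoly q" for p q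
    by (rule poly_eqI) (simp add: coeff_map_poly coeff_mult)
  then show ?thesis by (induction I rule: infinite_finite_induct) simp_all
qed

lemma higher_pderiv_cpoly: "(pderiv ^^ n) (cpoly p) = cpoly ((pderiv ^^ n) p)"
  by (rule poly_eqI)
    (simp add: coeff_higher_pderiv coeff_map_poly pochhammer_of_real[symmetric] del: pochhammer_Suc)

lemma cpoly_split_off_real_roots:
  assumes S: "lead_coeff S = 1" and Y: "finite Y" "\<And>y. y \<in> Y \<Longrightarrow> poly S y = 0"
  obtains A where "size A + card Y = degree S"
    and "cpoly S = (\<Prod>z\<in>#A. [:-z, 1:]) * (\<Prod>y\<in>Y. [:- of_real y, 1:])"
proof -
  let ?B = "mset_set (complex_of_real ` Y)"
  have S0: "S \<noteq> 0" using S by auto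
  then have C0: "cpoly S \<noteq> 0" by (simp add: map_poly_eq_0_iff)
  have deg: "degree (cpoly S) = degree S" by (simp add: degree_map_poly)
  have "complex_of_real ` Y \<subseteq> set_mset (proots (cpoly S))"
    using C0 Y(2) by (auto simp: poly_cpoly)
  then have "?B \<subseteq># mset_set (set_mset (proots (cpoly S)))"
    by (intro subset_imp_msubset_mset_set) simp_all
  then have "?B \<subseteq># proots (cpoly S)"
    using mset_set_set_mset_msubset subset_mset.order_trans by blast
  then obtain A where A: "proots (cpoly S) = ?B + A" by (auto simp: subset_mset.le_iff_add)
  have inj: "inj_on complex_of_real Y" by (simp add: inj_on_def)
  have "size ?B + size A = degree S"
    using size_proots_complex[of "cpoly S"] deg A by simp
  then have "size A + card Y = degree S" using inj by (simp add: card_image)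
  moreover have "cpoly S = (\<Prod>z\<in>#proots (cpoly S). [:-z, 1:])"
    using complex_poly_decompose_multiset[of "cpoly S"] S deg by (simp add: coeff_map_poly)
  then have "cpoly S = (\<Prod>z\<in>#A. [:-z, 1:]) * (\<Prod>y\<in>Y. [:- of_real y, 1:])"
    unfolding A using Y(1) inj
    by (simp add: prod_unfold_prod_mset[symmetric] prod.reindex mult.commute)
  ultimately show ?thesis using that by blast
qed

lemma poly_higher_pderiv_linear_factor:
  fixes f :: "'a :: idom poly"
  shows "poly ((pderiv ^^ j) ([:-z, 1:] * f)) c =
    (c - z) * poly ((pderiv ^^ j) f) c + of_nat j * poly ((pderiv ^^ (j - 1)) f) c"
proof -
  have "(pderiv ^^ j) ([:-z, 1:] * f) =
     [:-z, 1:] * (pderiv ^^ j) f + smult (of_nat j) ((pderiv ^^ (j - 1)) f)"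
  proof (induction j)
    case (Suc j)
    have "pderiv (smult (of_nat j) ((pderiv ^^ (j - 1)) f)) = smult (of_nat j) ((pderiv ^^ j) f)"
      by (cases j) (simp_all add: pderiv_smult)
    moreover have "pderiv ([:-z, 1:] * g) = [:-z, 1:] * pderiv g + g" for g :: "'a poly"
      by (simp add: pderiv_mult pderiv_pCons del: mult_pCons_left)
    ultimately show ?case by (simp add: Suc.IH pderiv_add smult_add_left del: mult_pCons_left)
  qed simp
  then have "poly ((pderiv ^^ j) ([:-z, 1:] * f)) c =
      poly ([:-z, 1:] * (pderiv ^^ j) f + smult (of_nat j) ((pderiv ^^ (j - 1)) f)) c"
    by (rule arg_cong)
  then show ?thesis by (simp add: algebra_simps del: mult_pCons_left)
qed

text \<open>
  For real-rooted polynomials the estimate of \<open>f\<^sup>(\<^sup>j\<^sup>+\<^sup>1\<^sup>) / f\<^sup>(\<^sup>j\<^sup>)\<close> by a sum of terms \<open>1 / (c - y)\<close> can be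
  obtained by adding one linear factor at a time, without locating the zeros of the derivatives. The
  signed values \<open>F\<close> make all quantities nonnegative for both signs of \<open>c\<close>.
\<close>
lemma higher_pderiv_growth_of_real_rooted:
  fixes c :: real
  assumes c: "1 < \<bar>c\<bar>" and Y: "finite Y" "Y \<subseteq> {-1<..<1}"
  shows "(real (card Y) - real j) * \<bar>poly ((pderiv ^^ j) (\<Prod>y\<in>Y. [:-y, 1:])) c\<bar>
    \<le> (\<bar>c\<bar> + 1) * \<bar>poly ((pderiv ^^ Suc j) (\<Prod>y\<in>Y. [:-y, 1:])) c\<bar>"
proof -
  define s where "s = sgn c"
  have s: "s * s = 1" "\<bar>s\<bar> = 1" using c by (auto simp: s_def sgn_if)
  define F where "F Y j = s ^ (card Y + j) * poly ((pderiv ^^ j) (\<Prod>y\<in>Y. [:-y, 1:])) c" for Y j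
  have "0 \<le> F Y j \<and> (real (card Y) - real j) * F Y j \<le> (\<bar>c\<bar> + 1) * F Y (Suc j)" for j
    using Y
  proof (induction Y arbitrary: j rule: finite_induct)
    case empty
    have "(pderiv ^^ Suc i) (1 :: real poly) = 0" for i
      by (induction i) simp_all
    then show ?case by (cases j) (simp_all add: F_def)
  next
    case (insert y Y)
    define u where "u = s * (c - y)"
    have u: "0 < u" "u \<le> \<bar>c\<bar> + 1" using insert.prems c by (auto simp: u_def s_def sgn_if)
    have nn: "0 \<le> F Y i" and IH: "(real (card Y) - real i) * F Y i \<le> (\<bar>c\<bar> + 1) * F Y (Suc i)" for i
      using insert.IH[of i] insert.prems by auto
    have rec: "F (insert y Y) i = u * F Y i + real i * F Y (i - 1)" for i
    proof -
      let ?D = "\<lambda>i. poly ((pderiv ^^ i) (\<Prod>y\<in>Y. [:-y, 1:])) c"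
      have "F (insert y Y) i = s ^ Suc (card Y + i) * ((c - y) * ?D i + real i * ?D (i - 1))"
        using insert.hyps by (simp add: F_def poly_higher_pderiv_linear_factor del: mult_pCons_left)
      also have "\<dots> = u * F Y i + real i * (s ^ Suc (card Y + i) * ?D (i - 1))"
        by (simp add: u_def F_def algebra_simps)
      also have "real i * (s ^ Suc (card Y + i) * ?D (i - 1)) = real i * F Y (i - 1)"
      proof (cases i)
        case (Suc k)
        have "s ^ Suc (card Y + Suc k) = s * s * s ^ (card Y + k)" by simp
        then show ?thesis using s Suc by (simp add: F_def)
      qed simp
      finally show ?thesis .
    qed
    have "(real (card Y) + 1 - real j) * F (insert y Y) j
       = u * ((real (card Y) - real j) * F Y j) + u * F Y j
         + real j * ((real (card Y) + 1 - real j) * F Y (j - 1))"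
      by (simp add: rec algebra_simps)
    also have "\<dots> \<le> u * ((\<bar>c\<bar> + 1) * F Y (Suc j)) + (\<bar>c\<bar> + 1) * F Y j + real j * ((\<bar>c\<bar> + 1) * F Y j)"
    proof (intro add_mono)
      show "u * ((real (card Y) - real j) * F Y j) \<le> u * ((\<bar>c\<bar> + 1) * F Y (Suc j))"
        using IH[of j] u by (intro mult_left_mono) auto
      show "u * F Y j \<le> (\<bar>c\<bar> + 1) * F Y j" using u nn by (intro mult_right_mono) auto
      show "real j * ((real (card Y) + 1 - real j) * F Y (j - 1)) \<le> real j * ((\<bar>c\<bar> + 1) * F Y j)"
      proof (cases j)
        case (Suc i)
        then show ?thesis using IH[of i] by (intro mult_left_mono) auto
      qed simp
    qed
    also have "\<dots> = (\<bar>c\<bar> + 1) * F (insert y Y) (Suc j)"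
      by (simp add: rec algebra_simps)
    finally have "(real (card (insert y Y)) - real j) * F (insert y Y) j \<le> (\<bar>c\<bar> + 1) * F (insert y Y) (Suc j)"
      using insert.hyps by (simp add: add.commute)
    then show ?case using nn u by (simp add: rec)
  qed
  moreover have "\<bar>F Y i\<bar> = \<bar>poly ((pderiv ^^ i) (\<Prod>y\<in>Y. [:-y, 1:])) c\<bar>" for i
    using s by (simp add: F_def abs_mult power_abs)
  ultimately show ?thesis by (metis abs_of_nonneg)
qed

text \<open>
  This property with large \<open>M\<close> is inherited from the real-rooted part of a polynomial by the polynomial
  itself: each further linear factor whose zero stays away from \<open>c\<close> costs at most a factor 2
  in \<open>M\<close>, as long as \<open>M\<close> is large enough.
\<close>
definition derivs_grow :: "real \<Rightarrow> nat \<Rightarrow> complex \<Rightarrow> complex poly \<Rightarrow> bool" where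
  "derivs_grow M d c f \<longleftrightarrow>
     (\<forall>j<d. M * norm (poly ((pderiv ^^ j) f) c) \<le> norm (poly ((pderiv ^^ Suc j) f) c))"

text \<open>
  By the product rule the \<open>j\<close>-th derivative of \<open>(x - z) f\<close> at \<open>c\<close> is \<open>(c - z) f\<^sup>(\<^sup>j\<^sup>)(c)\<close> up to
  the error \<open>j f\<^sup>(\<^sup>j\<^sup>-\<^sup>1\<^sup>)(c)\<close>, which is at most a third of the main term when \<open>3 d \<le> M \<delta>\<close>.
\<close>
lemma derivs_grow_linear_factor:
  assumes f: "derivs_grow M d c f" and z: "\<delta> \<le> norm (c - z)" "0 < \<delta>" and M: "3 * real d / \<delta> \<le> M" "0 < M"
  shows "derivs_grow (M / 2) d c ([:-z, 1:] * f)"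
  unfolding derivs_grow_def
proof (intro allI impI)
  fix j assume j: "j < d"
  let ?D = "\<lambda>j. norm (poly ((pderiv ^^ j) f) c)"
  define \<rho> where "\<rho> = norm (c - z)"
  have \<rho>: "0 < \<rho>" using z unfolding \<rho>_def by linarith
  have "3 * real d \<le> M * \<delta>" using M z by (simp add: field_simps)
  also have "\<dots> \<le> M * \<rho>" using z M by (simp add: \<rho>_def)
  finally have dM: "3 * real d \<le> M * \<rho>" .
  have lower: "real i * ?D (i - 1) \<le> \<rho> / 3 * ?D i" if "i \<le> d" for i
  proof (cases i)
    case (Suc k)
    then have grow: "M * ?D k \<le> ?D i" using f that by (simp add: derivs_grow_def)
    have "real i * ?D k \<le> M * \<rho> / 3 * ?D k"
      using that dM by (intro mult_right_mono) auto
    also have "\<dots> = \<rho> / 3 * (M * ?D k)" by simp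
    also have "\<dots> \<le> \<rho> / 3 * ?D i" using grow \<rho> by (intro mult_left_mono) auto
    finally show ?thesis using Suc by simp
  qed (use \<rho> in simp)
  have upper: "norm (poly ((pderiv ^^ j) ([:-z, 1:] * f)) c) \<le> 4 / 3 * \<rho> * ?D j"
  proof -
    have "norm (poly ((pderiv ^^ j) ([:-z, 1:] * f)) c) \<le> \<rho> * ?D j + real j * ?D (j - 1)"
      unfolding poly_higher_pderiv_linear_factor \<rho>_def
      by (rule order_trans[OF norm_triangle_ineq]) (simp add: norm_mult)
    with lower[of j] j show ?thesis by simp
  qed
  have "\<rho> * ?D (Suc j) - real (Suc j) * ?D j \<le> norm (poly ((pderiv ^^ Suc j) ([:-z, 1:] * f)) c)"
    unfolding poly_higher_pderiv_linear_factor \<rho>_def diff_Suc_1 norm_mult[symmetric]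
    using norm_diff_ineq[of "(c - z) * poly ((pderiv ^^ Suc j) f) c" "of_nat (Suc j) * poly ((pderiv ^^ j) f) c"]
    by (simp add: norm_mult del: of_nat_Suc)
  with lower[of "Suc j"] j have "2 / 3 * \<rho> * ?D (Suc j) \<le> norm (poly ((pderiv ^^ Suc j) ([:-z, 1:] * f)) c)"
    by simp
  moreover have "M / 2 * norm (poly ((pderiv ^^ j) ([:-z, 1:] * f)) c) \<le> M / 2 * (4 / 3 * \<rho> * ?D j)"
    using upper M by (intro mult_left_mono) auto
  moreover have "M / 2 * (4 / 3 * \<rho> * ?D j) = 2 / 3 * \<rho> * (M * ?D j)" by simp
  moreover have "2 / 3 * \<rho> * (M * ?D j) \<le> 2 / 3 * \<rho> * ?D (Suc j)"
    using f j \<rho> by (intro mult_left_mono) (auto simp: derivs_grow_def)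
  ultimately show "M / 2 * norm (poly ((pderiv ^^ j) ([:-z, 1:] * f)) c)
      \<le> norm (poly ((pderiv ^^ Suc j) ([:-z, 1:] * f)) c)"
    by linarith
qed

lemma derivs_grow_linear_factors:
  assumes "derivs_grow M d c f" "\<And>z. z \<in># A \<Longrightarrow> \<delta> \<le> norm (c - z)" "0 < \<delta>"
    and "2 ^ size A * (3 * real d / \<delta> + 1) \<le> M"
  shows "derivs_grow (M / 2 ^ size A) d c ((\<Prod>z\<in>#A. [:-z, 1:]) * f)"
  using assms(2,4)
proof (induction A)
  case empty
  then show ?case using assms(1) by simp
next
  case (add z A)
  define K where "K = 3 * real d / \<delta> + 1"
  have K: "0 < K" using assms(3) by (simp add: K_def add_nonneg_pos)
  have MK: "2 * (2 ^ size A * K) \<le> M" using add.prems(2) by (simp add: K_def mult_ac)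
  moreover have "0 < 2 ^ size A * K" using K by simp
  ultimately have "2 ^ size A * K \<le> M" by linarith
  then have IH: "derivs_grow (M / 2 ^ size A) d c ((\<Prod>z\<in>#A. [:-z, 1:]) * f)"
    using add.prems(1) by (intro add.IH) (auto simp: K_def)
  have "K \<le> M / 2 ^ size A" using \<open>2 ^ size A * K \<le> M\<close> by (simp add: field_simps)
  then have "derivs_grow (M / 2 ^ size A / 2) d c ([:-z, 1:] * ((\<Prod>z\<in>#A. [:-z, 1:]) * f))"
    using add.prems(1) assms(3) K by (intro derivs_grow_linear_factor[OF IH]) (auto simp: K_def)
  then show ?case by (simp add: mult_ac del: mult_pCons_left mult_pCons_right)
qed

lemma derivs_grow_imp_norm_le:
  assumes "derivs_grow M d c f" "1 \<le> M"
  shows "norm (poly f c) \<le> norm (poly ((pderiv ^^ d) f) c)"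
proof -
  have "norm (poly f c) \<le> norm (poly ((pderiv ^^ j) f) c)" if "j \<le> d" for j
    using that
  proof (induction j)
    case (Suc j)
    have "norm (poly ((pderiv ^^ j) f) c) \<le> M * norm (poly ((pderiv ^^ j) f) c)"
      using assms(2) by (intro mult_right_mono[of 1 M, simplified]) auto
    moreover have "M * norm (poly ((pderiv ^^ j) f) c) \<le> norm (poly ((pderiv ^^ Suc j) f) c)"
      using assms(1) Suc.prems unfolding derivs_grow_def by (metis Suc_le_lessD)
    moreover have "norm (poly f c) \<le> norm (poly ((pderiv ^^ j) f) c)" using Suc by simp
    ultimately show ?case by (meson order_trans)
  qed simp
  then show ?thesis by blast
qed

text \<open>
  The zeros in \<open>Y\<close> force growth by a factor of about \<open>n\<close> per derivative, and the at most \<open>N\<close> further factors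
  reduce it by at most \<open>2\<^sup>N\<close>, so at least a factor 1 remains for large \<open>n\<close>.
\<close>
lemma abs_poly_le_abs_higher_pderiv:
  fixes c :: real
  assumes c: "1 < \<bar>c\<bar>" and \<delta>: "0 < \<delta>" and S: "lead_coeff S = 1" "degree S = n"
    and Y: "finite Y" "Y \<subseteq> {-1<..<1}" "\<And>y. y \<in> Y \<Longrightarrow> poly S y = 0" "n \<le> card Y + N"
    and far: "\<And>z. poly (cpoly S) z = 0 \<Longrightarrow> \<delta> \<le> norm (of_real c - z)"
    and large: "real N + real d + (\<bar>c\<bar> + 1) * (2 ^ N * (3 * real d / \<delta> + 1)) \<le> real n"
  shows "\<bar>poly S c\<bar> \<le> \<bar>poly ((pderiv ^^ d) S) c\<bar>"
proof -
  obtain A where A: "size A + card Y = degree S"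
    "cpoly S = (\<Prod>z\<in>#A. [:-z, 1:]) * (\<Prod>y\<in>Y. [:- of_real y, 1:])"
    using cpoly_split_off_real_roots[OF S(1) Y(1,3)] by blast
  define K where "K = 3 * real d / \<delta> + 1"
  have K: "1 \<le> K" using \<delta> by (simp add: K_def)
  define M where "M = 2 ^ N * K"
  have sA: "size A \<le> N" using A Y(4) S(2) by simp
  have "2 ^ size A * 1 \<le> 2 ^ N * K"
    using sA K by (intro mult_mono power_increasing) auto
  then have M: "2 ^ size A \<le> M" "0 < M" using K by (simp_all add: M_def)
  have prodY: "(\<Prod>y\<in>Y. [:- complex_of_real y, 1:]) = cpoly (\<Prod>y\<in>Y. [:-y, 1:])"
    by (simp add: cpoly_prod map_poly_pCons)
  have "derivs_grow M d (of_real c) (cpoly (\<Prod>y\<in>Y. [:-y, 1:]))"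
    unfolding derivs_grow_def
  proof (intro allI impI)
    fix j assume "j < d"
    let ?D = "\<lambda>j. \<bar>poly ((pderiv ^^ j) (\<Prod>y\<in>Y. [:-y, 1:])) c\<bar>"
    have "(\<bar>c\<bar> + 1) * M \<le> real (card Y) - real j"
      using large \<open>j < d\<close> Y(4) by (simp add: M_def K_def)
    then have "(\<bar>c\<bar> + 1) * M * ?D j \<le> (real (card Y) - real j) * ?D j"
      by (intro mult_right_mono) auto
    also have "\<dots> \<le> (\<bar>c\<bar> + 1) * ?D (Suc j)"
      by (rule higher_pderiv_growth_of_real_rooted[OF c Y(1,2)])
    finally have "(\<bar>c\<bar> + 1) * (M * ?D j) \<le> (\<bar>c\<bar> + 1) * ?D (Suc j)" by (simp only: mult.assoc)
    then have "M * ?D j \<le> ?D (Suc j)" using c by (simp only: mult_le_cancel_left_pos)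
    then show "M * norm (poly ((pderiv ^^ j) (cpoly (\<Prod>y\<in>Y. [:-y, 1:]))) (of_real c))
        \<le> norm (poly ((pderiv ^^ Suc j) (cpoly (\<Prod>y\<in>Y. [:-y, 1:]))) (of_real c))"
      unfolding higher_pderiv_cpoly poly_cpoly norm_of_real .
  qed
  then have "derivs_grow (M / 2 ^ size A) d (of_real c) (cpoly S)"
    unfolding A(2) prodY
  proof (rule derivs_grow_linear_factors)
    show "\<delta> \<le> norm (of_real c - z)" if "z \<in># A" for z
      using that by (intro far) (auto simp: A(2) poly_prod_mset prod_mset_zero_iff)
    show "2 ^ size A * (3 * real d / \<delta> + 1) \<le> M"
      using sA K by (auto simp: M_def K_def[symmetric] intro!: mult_right_mono)
  qed fact
  then have "norm (poly (cpoly S) (of_real c)) \<le> norm (poly ((pderiv ^^ d) (cpoly S)) (of_real c))"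
  proof (rule derivs_grow_imp_norm_le)
    show "1 \<le> M / 2 ^ size A" using M(1) by (subst le_divide_eq_1_pos) simp_all
  qed
  then show ?thesis unfolding higher_pderiv_cpoly poly_cpoly norm_of_real .
qed

lemma prod_dist_real_roots_le:
  fixes c :: real
  assumes \<delta>: "0 < \<delta>" "\<delta> \<le> 1" and S: "lead_coeff S = 1" "degree S = n"
    and Y: "finite Y" "\<And>y. y \<in> Y \<Longrightarrow> poly S y = 0" "n \<le> card Y + m"
    and far: "\<And>z. poly (cpoly S) z = 0 \<Longrightarrow> \<delta> \<le> norm (of_real c - z)"
  shows "\<delta> ^ m * (\<Prod>y\<in>Y. \<bar>c - y\<bar>) \<le> \<bar>poly S c\<bar>"
proof -
  obtain A where A: "size A + card Y = degree S"
    "cpoly S = (\<Prod>z\<in>#A. [:-z, 1:]) * (\<Prod>y\<in>Y. [:- of_real y, 1:])"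
    using cpoly_split_off_real_roots[OF S(1) Y(1,2)] by blast
  have dist: "\<delta> \<le> norm (of_real c - z)" if "z \<in># A" for z
    using that by (intro far) (auto simp: A(2) poly_prod_mset prod_mset_zero_iff)
  have "\<delta> ^ size A \<le> norm (poly (\<Prod>z\<in>#A. [:-z, 1:]) (of_real c))"
    using dist
  proof (induction A)
    case (add z A)
    have "\<delta> * \<delta> ^ size A \<le> norm (of_real c - z) * norm (poly (\<Prod>z\<in>#A. [:-z, 1:]) (of_real c))"
      using add \<delta> by (intro mult_mono) auto
    then show ?case by (simp add: norm_mult[symmetric] algebra_simps)
  qed simp
  moreover have "\<delta> ^ m \<le> \<delta> ^ size A"
    using A(1) S(2) Y(3) \<delta> by (intro power_decreasing) auto
  moreover have "\<bar>poly S c\<bar> = norm (poly (cpoly S) (of_real c))"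
    by (simp add: poly_cpoly)
  moreover have "\<dots> = norm (poly (\<Prod>z\<in>#A. [:-z, 1:]) (of_real c)) * (\<Prod>y\<in>Y. \<bar>c - y\<bar>)"
    unfolding A(2) by (simp add: norm_mult poly_prod prod_norm[symmetric] flip: of_real_diff)
  ultimately show ?thesis by (simp add: mult_right_mono prod_nonneg)
qed

section \<open>Sobolev orthogonal polynomials have zeros near the mass points\<close>
lemma higher_pderiv_eq_0_at_multiple_root:
  fixes p :: "real poly"
  assumes "[:-c, 1:] ^ Suc k dvd p"
  shows "poly ((pderiv ^^ k) p) c = 0"
  using assms
proof (induction k arbitrary: p)
  case 0
  then show ?case by (simp add: poly_eq_0_iff_dvd)
next
  case (Suc k)
  from Suc.prems obtain q where q: "p = [:-c, 1:] ^ Suc (Suc k) * q" by (rule dvdE)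
  have "pderiv p = [:-c, 1:] ^ Suc k * ([:-c, 1:] * pderiv q + smult (of_nat (Suc (Suc k))) q)"
    unfolding q pderiv_mult pderiv_power_Suc
    by (simp add: algebra_simps pderiv_pCons one_pCons[symmetric] del: mult_pCons_left mult_pCons_right)
  then have "[:-c, 1:] ^ Suc k dvd pderiv p" by (metis dvd_triv_left)
  from Suc.IH[OF this] show ?case by (simp add: funpow_swap1)
qed

context positive_functional
begin

lemma mono: "(\<And>x. x \<in> {-1<..<1} \<Longrightarrow> poly p x \<le> poly q x) \<Longrightarrow> L p \<le> L q"
  using nonneg[of "q - p"] by (simp add: linfun_diff[OF linear])

text \<open>
  Let \<open>w\<close> be the product of all \<open>(x - c)\<^sup>d\<^sup>+\<^sup>1\<close>. For multiples of \<open>w\<close> the discrete part of the inner product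
  disappears. This makes \<open>w * S n\<close> orthogonal with respect to \<open>L\<close> to all polynomials of degree less than
  \<open>n - degree w\<close>, and it makes \<open>w * P (n - degree w)\<close> a competitor for the minimality of \<open>S n\<close> whose squared
  Sobolev norm is at most a constant times \<open>\<tau> (n - degree w)\<close>. A zero-free disc around \<open>c j\<close> then leads to the upper and lower bounds
  for \<open>S n(c j)\<close> that contradict each other.
\<close>
lemma sobolev_zero_near_mass_point:
  fixes \<eta> c :: "'i \<Rightarrow> real" and d :: "'i \<Rightarrow> nat" and S P :: "nat \<Rightarrow> real poly"
  assumes nest: "nested_constraints J c d"
    and J: "\<And>i. i \<in> J \<Longrightarrow> 0 < \<eta> i" "\<And>i. i \<in> J \<Longrightarrow> 1 < \<bar>c i\<bar>"
    and S: "\<And>n. degree (S n) = n" "\<And>n. lead_coeff (S n) = 1"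
    and S_orth: "\<And>n q. degree q < n \<Longrightarrow> L (q * S n) + (\<Sum>i\<in>J. \<eta> i *
          poly ((pderiv ^^ d i) q) (c i) * poly ((pderiv ^^ d i) (S n)) (c i)) = 0"
    and P: "\<And>n. orthogonal_monic (P n) n"
    and ratio: "\<forall>\<^sub>F n in sequentially. L (P n * P n) \<le> K * L (P (Suc n) * P (Suc n))"
    and j: "j \<in> J" and \<delta>0: "0 < \<delta>0"
  shows "\<forall>\<^sub>F n in sequentially. \<exists>z. poly (cpoly (S n)) z = 0 \<and> norm (of_real (c j) - z) < \<delta>0"
proof -
  define \<delta> where "\<delta> = min \<delta>0 1"
  have \<delta>: "0 < \<delta>" "\<delta> \<le> 1" "\<delta> \<le> \<delta>0" using \<delta>0 by (auto simp: \<delta>_def)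
  have finJ: "finite J" using nest by (simp add: nested_constraints_def)
  define D where "D i p = poly ((pderiv ^^ d i) p) (c i)" for i p
  have D_diff: "D i (p - q) = D i p - D i q" for i p q
    using linfun_diff[OF linfun_poly_higher_pderiv] by (simp add: D_def)
  define B where "B p q = L (p * q) + (\<Sum>i\<in>J. \<eta> i * D i p * D i q)" for p q
  have SB: "B q (S n) = 0" if "degree q < n" for q n
    using S_orth[OF that] by (simp add: B_def D_def)
  define w where "w = (\<Prod>i\<in>J. [:- c i, 1:] ^ Suc (d i))"
  define m where "m = degree w"
  have Dw: "D i (w * q) = 0" if "i \<in> J" for i q
  proof -
    have "[:- c i, 1:] ^ Suc (d i) dvd w" unfolding w_def using that finJ by (rule dvd_prodI[rotated])
    then show ?thesis unfolding D_def
      by (intro higher_pderiv_eq_0_at_multiple_root dvd_mult2)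
  qed
  have w_nz: "poly w x \<noteq> 0" if "x \<in> {-1<..<1}" for x
    using that J(2) finJ by (force simp: w_def poly_prod)
  from w_nz[of 0] have w0: "w \<noteq> 0" by auto
  have w_monic: "lead_coeff w = 1" unfolding w_def lead_coeff_prod by (simp add: lead_coeff_power del: power_Suc)
  define W where "W = (\<Prod>i\<in>J. (\<bar>c i\<bar> + 1) ^ Suc (d i))"
  have W: "0 < W" unfolding W_def by (intro prod_pos ballI zero_less_power) auto
  have w_le: "\<bar>poly w x\<bar> \<le> W" if "x \<in> {-1<..<1}" for x
    using that unfolding w_def W_def poly_prod abs_prod poly_power power_abs
    by (intro prod_mono conjI power_mono) auto
  define \<tau> where "\<tau> n = L (P n * P n)" for n
  have dP: "degree (P n) = n" "lead_coeff (P n) = 1" for n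
    using P[of n] by (auto simp: orthogonal_monic_def)
  have \<tau>: "0 < \<tau> n" for n unfolding \<tau>_def using dP(2)[of n] by (intro pos) auto
  define N where "N = card J"
  have c: "1 < \<bar>c j\<bar>" using J(2) j by blast
  define H where "H = \<bar>c j\<bar> + 1"
  have H: "0 < H" unfolding H_def by simp

  have minimal: "\<eta> j * (D j (S n))\<^sup>2 \<le> W\<^sup>2 * \<tau> (n - m)" if n: "m \<le> n" for n
  proof (cases "w * P (n - m) = S n")
    case True
    then have "D j (S n) = 0" using Dw[OF j] by metis
    then show ?thesis using \<tau>[of "n - m"] by (simp add: less_imp_le)
  next
    case False
    define T where "T = w * P (n - m)"
    have P0: "P (n - m) \<noteq> 0" using dP(2)[of "n - m"] by auto
    have T: "degree T = n" "lead_coeff T = 1"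
    proof -
      show "degree T = n" using n w0 P0 dP by (simp add: T_def m_def degree_mult_eq)
      have "lead_coeff T = lead_coeff w * lead_coeff (P (n - m))"
        unfolding T_def by (rule lead_coeff_mult)
      then show "lead_coeff T = 1" using w_monic dP(2) by simp
    qed
    have "degree (T - S n) < n"
    proof -
      have "degree (T - S n) \<le> n" using T(1) S(1) by (intro degree_diff_le) auto
      moreover have "coeff (T - S n) n = 0" using T S(2)[of n] S(1)[of n] by simp
      moreover have "T - S n \<noteq> 0" using False by (simp add: T_def)
      ultimately show ?thesis by (metis eq_zero_or_degree_less)
    qed
    then have orth: "B (T - S n) (S n) = 0" by (rule SB)
    have BT: "B T T = B (S n) (S n) + 2 * B (T - S n) (S n) + B (T - S n) (T - S n)"
    proof -
      \<comment> \<open>\<open>T\<close> is \<open>S n\<close> plus a polynomial of lower degree, which is orthogonal to \<open>S n\<close>: Pythagoras.\<close>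
      have square: "T * T = S n * S n + ((T - S n) * S n + (T - S n) * S n) + (T - S n) * (T - S n)"
        by (simp add: algebra_simps)
      have "L (T * T) = L (S n * S n) + 2 * L ((T - S n) * S n) + L ((T - S n) * (T - S n))"
        unfolding square linfun_add[OF linear] by simp
      then show ?thesis
        by (simp add: B_def D_diff sum_distrib_left sum.distrib[symmetric] algebra_simps)
    qed
    have B_nonneg: "\<eta> j * (D j p)\<^sup>2 \<le> B p p" for p
    proof -
      have "\<eta> j * (D j p)\<^sup>2 = (\<Sum>i\<in>{j}. \<eta> i * D i p * D i p)" by (simp add: power2_eq_square)
      also have "\<dots> \<le> (\<Sum>i\<in>J. \<eta> i * D i p * D i p)"
        using j J(1) finJ by (intro sum_mono2) (auto simp: mult.assoc less_imp_le)
      also have "\<dots> \<le> B p p" unfolding B_def using nonneg[of "p * p"] by simp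
      finally show ?thesis .
    qed
    have "0 \<le> \<eta> j * (D j (T - S n))\<^sup>2" using J(1)[OF j] by (simp add: less_imp_le)
    then have "0 \<le> B (T - S n) (T - S n)" using B_nonneg order_trans by blast
    have "\<eta> j * (D j (S n))\<^sup>2 \<le> B (S n) (S n)" by (rule B_nonneg)
    also have "\<dots> \<le> B T T" using BT orth \<open>0 \<le> B (T - S n) (T - S n)\<close> by simp
    also have "\<dots> = L (T * T)" by (simp add: B_def T_def Dw)
    also have "\<dots> \<le> L (smult (W\<^sup>2) (P (n - m) * P (n - m)))"
    proof (rule mono)
      fix x :: real assume "x \<in> {-1<..<1}"
      then have "(poly w x)\<^sup>2 \<le> W\<^sup>2" using w_le[of x] W by (simp add: abs_le_square_iff[symmetric])
      then have "(poly w x)\<^sup>2 * (poly (P (n - m)) x)\<^sup>2 \<le> W\<^sup>2 * (poly (P (n - m)) x)\<^sup>2"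
        by (intro mult_right_mono) auto
      then show "poly (T * T) x \<le> poly (smult (W\<^sup>2) (P (n - m) * P (n - m))) x"
        by (simp add: T_def power2_eq_square mult_ac)
    qed
    also have "\<dots> = W\<^sup>2 * \<tau> (n - m)" by (simp add: \<tau>_def linfun_smult[OF linear])
    finally show ?thesis .
  qed

  obtain n0 where n0: "\<And>n. n0 \<le> n \<Longrightarrow> \<tau> n \<le> K * \<tau> (Suc n)"
    using ratio unfolding eventually_sequentially \<tau>_def by blast
  have K: "0 < K" using n0[of n0] \<tau>[of n0] \<tau>[of "Suc n0"]
    by (metis le_refl order_less_le_trans zero_less_mult_pos2)
  \<comment> \<open>Iterating the ratio bound compares \<open>\<tau> (n - m)\<close> with \<open>\<tau> n\<close>; here \<open>m\<close> does not depend on \<open>n\<close>.\<close>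
  have \<tau>_ratio: "\<tau> n \<le> K ^ k * \<tau> (n + k)" if "n0 \<le> n" for n k
  proof (induction k)
    case (Suc k)
    also have "K ^ k * \<tau> (n + k) \<le> K ^ k * (K * \<tau> (Suc (n + k)))"
      using n0[of "n + k"] K that by (intro mult_left_mono) auto
    finally show ?case by (simp add: mult_ac)
  qed simp

  define E where "E = sqrt (W\<^sup>2 * K ^ m / \<eta> j)"
  define C where "C = H ^ m * (H * (1 + L 1)) * E / (2 * (\<bar>c j\<bar> - 1) * \<delta> ^ m)"
  have contra: "\<bar>c j\<bar> ^ n \<le> C"
    if n: "n0 + m \<le> n" "real N + real (d j) + (\<bar>c j\<bar> + 1) * (2 ^ N * (3 * real (d j) / \<delta> + 1)) \<le> real n"
      and far: "\<And>z. poly (cpoly (S n)) z = 0 \<Longrightarrow> \<delta> \<le> norm (of_real (c j) - z)" for n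
  proof -
    have S0: "S n \<noteq> 0" using S(2)[of n] by auto
    have "\<exists>X. finite X \<and> X \<subseteq> {-1<..<1} \<and> (\<forall>x\<in>X. poly (S n) x = 0) \<and> n \<le> card X + card J"
    proof (rule exists_zeros_inside[OF nest S0])
      show "L (q * S n) = 0" if "degree q < n" "\<And>i. i \<in> J \<Longrightarrow> poly ((pderiv ^^ d i) q) (c i) = 0" for q
        using S_orth[OF that(1)] that(2) by simp
    qed
    then obtain X where X: "finite X" "X \<subseteq> {-1<..<1}" "\<And>x. x \<in> X \<Longrightarrow> poly (S n) x = 0" "n \<le> card X + N"
      unfolding N_def by blast
    have "\<bar>poly (S n) (c j)\<bar> \<le> \<bar>D j (S n)\<bar>"
      unfolding D_def
      by (rule abs_poly_le_abs_higher_pderiv[OF c \<delta>(1) S(2) S(1) X far n(2)])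
    also have "\<dots> \<le> E * sqrt (\<tau> n)"
    proof -
      have "\<eta> j * (D j (S n))\<^sup>2 \<le> W\<^sup>2 * \<tau> (n - m)" using n(1) by (intro minimal) simp
      also have "\<dots> \<le> W\<^sup>2 * (K ^ m * \<tau> n)"
        using \<tau>_ratio[of "n - m" m] n(1) by (intro mult_left_mono) auto
      finally have "(D j (S n))\<^sup>2 \<le> W\<^sup>2 * K ^ m / \<eta> j * \<tau> n"
        using J(1)[OF j] by (simp add: field_simps)
      then have "sqrt ((D j (S n))\<^sup>2) \<le> sqrt (W\<^sup>2 * K ^ m / \<eta> j * \<tau> n)" by (rule real_sqrt_le_mono)
      then show ?thesis unfolding E_def real_sqrt_abs real_sqrt_mult[symmetric] .
    qed
    finally have upper: "\<bar>poly (S n) (c j)\<bar> \<le> E * sqrt (\<tau> n)" .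
    have "\<exists>Y. finite Y \<and> Y \<subseteq> {-1<..<1} \<and> (\<forall>y\<in>Y. poly (S n) y = 0) \<and> n \<le> card Y + m \<and>
           \<bar>poly (P n) (c j)\<bar> \<le> (\<bar>c j\<bar> + 1) ^ m * (\<Prod>y\<in>Y. \<bar>c j - y\<bar>)"
    proof (rule quasi_orthogonal_zeros[OF P S(1) S0 w0 w_nz m_def[symmetric] _ c])
      fix q :: "real poly" assume q: "degree q + m < n"
      have "degree (q * w) < n" using q degree_mult_le[of q w] by (simp add: m_def)
      then have "B (w * q) (S n) = 0" by (intro SB) (simp add: mult.commute)
      then have "L (w * q * S n) = 0" by (simp add: B_def Dw)
      then show "L (q * (w * S n)) = 0" by (simp add: mult_ac)
    qed
    then obtain Y where Y: "finite Y" "\<And>y. y \<in> Y \<Longrightarrow> poly (S n) y = 0" "n \<le> card Y + m"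
      "\<bar>poly (P n) (c j)\<bar> \<le> H ^ m * (\<Prod>y\<in>Y. \<bar>c j - y\<bar>)" unfolding H_def by blast
    have lower: "\<delta> ^ m * (\<Prod>y\<in>Y. \<bar>c j - y\<bar>) \<le> \<bar>poly (S n) (c j)\<bar>"
      using far by (intro prod_dist_real_roots_le[OF \<delta>(1,2) S(2) S(1) Y(1-3)])
    have L1: "0 < L 1" by (intro pos) auto
    have "\<bar>c j\<bar> ^ n * sqrt (\<tau> n) * (2 * (\<bar>c j\<bar> - 1)) \<le> \<bar>poly (P n) (c j)\<bar> * (H * (1 + L 1))"
      using orthogonal_monic_growth[OF c P P] by (simp add: \<tau>_def H_def)
    then have "\<delta> ^ m * (\<bar>c j\<bar> ^ n * sqrt (\<tau> n) * (2 * (\<bar>c j\<bar> - 1)))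
       \<le> \<delta> ^ m * (\<bar>poly (P n) (c j)\<bar> * (H * (1 + L 1)))"
      using \<delta> by (intro mult_left_mono) auto
    also have "\<dots> \<le> \<delta> ^ m * (H ^ m * (\<Prod>y\<in>Y. \<bar>c j - y\<bar>) * (H * (1 + L 1)))"
      using \<delta> H L1 Y(4) by (intro mult_left_mono mult_right_mono) auto
    also have "\<dots> = H ^ m * (H * (1 + L 1)) * (\<delta> ^ m * (\<Prod>y\<in>Y. \<bar>c j - y\<bar>))" by simp
    also have "\<dots> \<le> H ^ m * (H * (1 + L 1)) * (E * sqrt (\<tau> n))"
      using lower upper H L1 by (intro mult_left_mono) auto
    finally have "\<bar>c j\<bar> ^ n * (2 * (\<bar>c j\<bar> - 1) * \<delta> ^ m) * sqrt (\<tau> n)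
        \<le> H ^ m * (H * (1 + L 1)) * E * sqrt (\<tau> n)"
      by (simp add: mult_ac)
    then have "\<bar>c j\<bar> ^ n * (2 * (\<bar>c j\<bar> - 1) * \<delta> ^ m) \<le> H ^ m * (H * (1 + L 1)) * E"
      using \<tau>[of n] by (simp only: mult_le_cancel_right_pos real_sqrt_gt_zero)
    then show ?thesis unfolding C_def using c \<delta> by (subst pos_le_divide_eq) auto
  qed

  obtain k where "C < \<bar>c j\<bar> ^ k" using real_arch_pow[OF c] by blast
  then have "C < \<bar>c j\<bar> ^ n" if "k \<le> n" for n
    using power_increasing[OF that, of "\<bar>c j\<bar>"] c by linarith
  then have "\<forall>\<^sub>F n in sequentially. C < \<bar>c j\<bar> ^ n"
    unfolding eventually_sequentially by blast
  moreover have "\<forall>\<^sub>F n in sequentially. n0 + m \<le> n" by (rule eventually_ge_at_top)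
  moreover have "\<forall>\<^sub>F n in sequentially.
      real N + real (d j) + (\<bar>c j\<bar> + 1) * (2 ^ N * (3 * real (d j) / \<delta> + 1)) \<le> real n"
    using filterlim_real_sequentially by (simp add: filterlim_at_top)
  ultimately show ?thesis
  proof eventually_elim
    case (elim n)
    show ?case
    proof (rule ccontr)
      assume "\<not> ?case"
      then have "\<And>z. poly (cpoly (S n)) z = 0 \<Longrightarrow> \<delta> \<le> norm (of_real (c j) - z)"
        using \<delta>(3) by force
      from contra[OF elim(2,3) this] elim(1) show False by simp
    qed
  qed
qed

end

section \<open>Integration, sequential ordering and the Nevai class\<close>
lemma set_integrable_poly:
  assumes M: "borel_measure_on_Icc M"
  shows "set_integrable M {-1..1} (poly p)"
proof -
  have sets: "sets M = sets borel" and fin: "finite_measure M"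
    using M by (auto simp: borel_measure_on_Icc_def)
  interpret finite_measure M by fact
  have "compact (poly p ` {-1..1})"
    by (intro compact_continuous_image continuous_on_poly) auto
  then have "bounded (poly p ` {-1..1})" by (rule compact_imp_bounded)
  then obtain C where C: "\<forall>y\<in>poly p ` {-1..1}. norm y \<le> C" unfolding bounded_iff by (rule exE)
  have "poly p \<in> borel_measurable M"
    unfolding measurable_cong_sets[OF sets refl]
    by (intro borel_measurable_continuous_onI continuous_on_poly continuous_on_id)
  moreover have "{-1..1::real} \<in> sets M" unfolding sets by simp
  ultimately show ?thesis
    unfolding set_integrable_def
  proof (intro integrable_const_bound[of _ "\<bar>C\<bar>"] AE_I2)
    show "norm (indicator {-1..1} x *\<^sub>R poly p x) \<le> \<bar>C\<bar>" for x
      using bspec[OF C, of "poly p x"] by (cases "x \<in> {-1..1}") simp_all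
  qed simp
qed

lemma positive_functional_integral:
  assumes M: "borel_measure_on_Icc M" and supp: "measure_support M = {-1..1}"
  shows "positive_functional (\<lambda>p. LINT x:{-1..1}|M. poly p x)"
proof
  show "linfun (\<lambda>p. LINT x:{-1..1}|M. poly p x)"
  proof -
    have "poly (p + q) = (\<lambda>x. poly p x + poly q x)" "poly (smult a p) = (\<lambda>x. a * poly p x)" for p q :: "real poly" and a
      by (simp_all add: fun_eq_iff)
    then show ?thesis
      unfolding linfun_def using set_integral_add(2)[OF set_integrable_poly[OF M] set_integrable_poly[OF M]]
      by simp
  qed
next
  fix p :: "real poly"
  assume p: "p \<noteq> 0" and nonneg: "\<And>x. x \<in> {-1<..<1} \<Longrightarrow> 0 \<le> poly p x"
  have sets: "sets M = sets borel" using M by (auto simp: borel_measure_on_Icc_def)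
  have closure: "0 \<le> poly p x" if "x \<in> {-1..1}" for x
  proof (rule continuous_ge_on_closure[of "{-1<..<1}" "poly p" x 0])
    show "continuous_on (closure {-1<..<1}) (poly p)" by (intro continuous_on_poly continuous_on_id)
  qed (use that nonneg in auto)
  have "infinite {-1<..<1::real}" by (rule infinite_Ioo) simp
  then obtain s where s: "s \<in> {-1<..<1}" "poly p s \<noteq> 0"
    using poly_roots_finite[OF p] finite_subset[of "{-1<..<1}" "{x. poly p x = 0}"] by blast
  define U where "U = {-1<..<1} \<inter> {x. poly p x \<noteq> 0}"
  have "open U" unfolding U_def
    by (intro open_Int open_Collect_neq continuous_on_poly continuous_on_id continuous_on_const) auto
  moreover have "s \<in> U" "s \<in> measure_support M" using s supp by (auto simp: U_def)
  ultimately have "0 < emeasure M U" by (auto simp: measure_support_def)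
  have int: "integrable M (\<lambda>x. indicator {-1..1} x *\<^sub>R poly p x)"
    using set_integrable_poly[OF M, of p] by (simp add: set_integrable_def)
  have ge: "AE x in M. 0 \<le> indicator {-1..1} x *\<^sub>R poly p x"
    using closure by (auto simp: indicator_def)
  show "0 < (LINT x:{-1..1}|M. poly p x)"
  proof (rule ccontr)
    assume "\<not> ?thesis"
    moreover have "0 \<le> (LINT x:{-1..1}|M. poly p x)"
      unfolding set_lebesgue_integral_def using ge by (rule integral_nonneg_AE)
    ultimately have "(LINT x|M. indicator {-1..1} x *\<^sub>R poly p x) = 0"
      by (simp add: set_lebesgue_integral_def)
    then have "AE x in M. indicator {-1..1} x *\<^sub>R poly p x = 0"
      using integral_nonneg_eq_0_iff_AE[OF int ge] by simp
    then have "AE x in M. x \<notin> U"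
      by eventually_elim (auto simp: U_def indicator_def split: if_splits)
    then have "emeasure M U = 0"
      using \<open>open U\<close> sets by (subst (asm) AE_iff_measurable[of U]) (auto intro: sets_eq_imp_space_eq simp: sets_eq_imp_space_eq[OF sets])
    with \<open>0 < emeasure M U\<close> show False by simp
  qed
qed

lemma monic_orthogonal_imp_orthogonal:
  assumes "monic_orthogonal ip S" "linfun (\<lambda>q. ip q (S n))" "degree q < n"
  shows "ip q (S n) = 0"
proof -
  have "ip q (S n) = ip (\<Sum>i\<le>degree q. smult (coeff q i) (monom 1 i)) (S n)"
    by (simp add: smult_monom poly_as_sum_of_monoms)
  also have "\<dots> = (\<Sum>i\<le>degree q. coeff q i * ip (monom 1 i) (S n))"
    by (simp only: linfun_sum[OF assms(2)] linfun_smult[OF assms(2)])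
  also have "\<dots> = 0"
  proof (intro sum.neutral ballI)
    fix i assume "i \<in> {..degree q}"
    then have "i < n" using assms(3) by simp
    then have "ip (monom 1 i) (S n) = 0" using assms(1) unfolding monic_orthogonal_def by blast
    then show "coeff q i * ip (monom 1 i) (S n) = 0" by simp
  qed
  finally show ?thesis .
qed

lemma sequentially_ordered_imp_nested:
  assumes "sequentially_ordered N c d"
  shows "nested_constraints {1..N} c d"
proof -
  obtain \<pi> where bij: "bij_betw \<pi> {1..N} {1..N}"
    and mono: "\<forall>i\<in>{1..N}. \<forall>j\<in>{1..N}. i \<le> j \<longrightarrow> d (\<pi> i) \<le> d (\<pi> j)"
    and out: "\<forall>k\<in>{1..N}. c (\<pi> k) \<notin> convex hull ({-1<..<1} \<union> (\<lambda>i. c (\<pi> i)) ` {1..<k})"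
    using assms unfolding sequentially_ordered_def by (elim exE conjE)
  have surj: "\<pi> ` {1..N} = {1..N}" using bij by (simp add: bij_betw_def)
  have neq: "c (\<pi> i) \<noteq> c (\<pi> k)" if "i < k" "i \<in> {1..N}" "k \<in> {1..N}" for i k
  proof
    assume "c (\<pi> i) = c (\<pi> k)"
    then have "c (\<pi> k) \<in> (\<lambda>i. c (\<pi> i)) ` {1..<k}" using that by (intro image_eqI[of _ _ i]) auto
    then have "c (\<pi> k) \<in> {-1<..<1} \<union> (\<lambda>i. c (\<pi> i)) ` {1..<k}" by blast
    then have "c (\<pi> k) \<in> convex hull ({-1<..<1} \<union> (\<lambda>i. c (\<pi> i)) ` {1..<k})"
      by (rule hull_inc)
    then show False using bspec[OF out that(3)] by contradiction
  qed
  have "inj_on (c \<circ> \<pi>) {1..N}"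
    by (rule linorder_inj_onI) (use neq in auto)
  then have "inj_on c (\<pi> ` {1..N})" by (rule inj_on_imageI)
  then have "inj_on c {1..N}" unfolding surj .
  moreover have "c j \<notin> convex hull ({-1<..<1} \<union> c ` {i \<in> {1..N}. d i < d j})" if j: "j \<in> {1..N}" for j
  proof -
    obtain k where k: "k \<in> {1..N}" "j = \<pi> k" using j surj by blast
    have "c ` {i \<in> {1..N}. d i < d j} \<subseteq> (\<lambda>i. c (\<pi> i)) ` {1..<k}"
    proof (intro image_subsetI)
      fix i assume i: "i \<in> {i \<in> {1..N}. d i < d j}"
      then obtain l where l: "l \<in> {1..N}" "i = \<pi> l" using surj by blast
      have "l < k"
      proof (rule ccontr)
        assume "\<not> l < k"
        then have "d (\<pi> k) \<le> d (\<pi> l)" using mono k(1) l(1) by simp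
        with i l k show False by simp
      qed
      with l show "c i \<in> (\<lambda>i. c (\<pi> i)) ` {1..<k}" by auto
    qed
    then have "convex hull ({-1<..<1} \<union> c ` {i \<in> {1..N}. d i < d j})
       \<subseteq> convex hull ({-1<..<1} \<union> (\<lambda>i. c (\<pi> i)) ` {1..<k})"
      by (intro hull_mono) auto
    with bspec[OF out k(1)] show ?thesis unfolding k(2) by (rule contra_subsetD[rotated])
  qed
  ultimately show ?thesis by (simp add: nested_constraints_def)
qed

section \<open>Location of all zeros\<close>
lemma czeros_mem_iff: "p \<noteq> 0 \<Longrightarrow> z \<in># czeros p \<longleftrightarrow> poly (cpoly p) z = 0"
  by (simp add: czeros_def map_poly_eq_0_iff)

lemma size_czeros: "size (czeros p) = degree p"
  by (simp add: czeros_def size_proots_complex degree_map_poly)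

text \<open>
  Since \<open>L (P (n + 1) * P (n + 1)) = (a (n + 1))\<^sup>2 * L (P n * P n)\<close> and \<open>a\<close> tends to \<open>1 / 2\<close>, any constant greater
  than 4 would do in place of 16.
\<close>
lemma nevai_norm_ratio:
  assumes M: "borel_measure_on_Icc M" and nevai: "nevai_class_0_1 M"
  defines "L \<equiv> \<lambda>p. LINT x:{-1..1}|M. poly p x"
  shows "\<exists>P. (\<forall>n. positive_functional.orthogonal_monic L (P n) n) \<and>
    (\<forall>\<^sub>F n in sequentially. L (P n * P n) \<le> 16 * L (P (Suc n) * P (Suc n)))"
proof -
  have supp: "measure_support M = {-1..1}" using nevai by (simp add: nevai_class_0_1_def)
  interpret positive_functional L unfolding L_def by (rule positive_functional_integral[OF M supp])
  obtain P a b where P: "monic_orthogonal (L2_ip M) P"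
    and rec: "\<And>n. 1 \<le> n \<Longrightarrow> P (n + 1) = [:- b n, 1:] * P n - smult ((a n)\<^sup>2) (P (n - 1))"
    and a: "a \<longlonglongrightarrow> 1 / 2"
    using nevai unfolding nevai_class_0_1_def by blast
  have ip: "L2_ip M p q = L (p * q)" for p q
  proof -
    have "poly (p * q) = (\<lambda>x. poly p x * poly q x)" by (simp add: fun_eq_iff)
    then show ?thesis by (simp add: L2_ip_def L_def)
  qed
  have lin: "linfun (\<lambda>q. L2_ip M q r)" for r
    unfolding ip using linear by (simp add: linfun_def distrib_right)
  have dP: "degree (P n) = n" "lead_coeff (P n) = 1" for n
    using P unfolding monic_orthogonal_def by blast+
  have orth: "L (q * P n) = 0" if "degree q < n" for q n
    using monic_orthogonal_imp_orthogonal[OF P lin that] by (simp add: ip)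
  have "L (P n * P n) \<le> 16 * L (P (Suc n) * P (Suc n))" if "1 / 4 < a (Suc n)" for n
  proof -
    let ?x = "[:- b (Suc n), 1:]"
    have P0: "P n \<noteq> 0" using dP(2)[of n] by auto
    have "degree (?x * P n - P (Suc n)) < Suc n"
    proof -
      have deg: "degree (?x * P n) = Suc n" using dP(1)[of n] P0 by (simp add: degree_mult_eq del: mult_pCons_left)
      have "lead_coeff (?x * P n) = lead_coeff ?x * lead_coeff (P n)" by (rule lead_coeff_mult)
      then have "coeff (?x * P n) (Suc n) = 1" using deg dP(2)[of n] by (simp del: mult_pCons_left)
      then have "coeff (?x * P n - P (Suc n)) (Suc n) = 0"
        using dP[of "Suc n"] by (simp del: mult_pCons_left)
      moreover have "degree (?x * P n - P (Suc n)) \<le> Suc n"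
        using deg dP(1)[of "Suc n"] by (intro degree_diff_le) auto
      ultimately show ?thesis by (metis eq_zero_or_degree_less degree_0 zero_less_Suc)
    qed
    then have "L ((?x * P n - P (Suc n)) * P (Suc n)) = 0" by (rule orth)
    moreover have "(?x * P n - P (Suc n)) * P (Suc n) = P n * (?x * P (Suc n)) - P (Suc n) * P (Suc n)"
      by (simp add: algebra_simps del: mult_pCons_left mult_pCons_right)
    moreover have "?x * P (Suc n) = P (Suc (Suc n)) + smult ((a (Suc n))\<^sup>2) (P n)"
      using rec[of "Suc n"] by (simp del: mult_pCons_left)
    ultimately have "L (P n * P (Suc (Suc n)) + smult ((a (Suc n))\<^sup>2) (P n * P n) - P (Suc n) * P (Suc n)) = 0"
      by (simp add: distrib_left)
    then have "L (P (Suc n) * P (Suc n)) = (a (Suc n))\<^sup>2 * L (P n * P n)"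
      using orth[of "P n" "Suc (Suc n)"] dP(1)[of n]
      by (simp add: linfun_diff[OF linear] linfun_add[OF linear] linfun_smult[OF linear])
    moreover have "(1 / 4)\<^sup>2 * L (P n * P n) \<le> (a (Suc n))\<^sup>2 * L (P n * P n)"
      using that pos[of "P n * P n"] P0 by (intro mult_right_mono power_mono) auto
    ultimately show ?thesis by (simp add: power2_eq_square)
  qed
  moreover have "\<forall>\<^sub>F n in sequentially. 1 / 4 < a (Suc n)"
    using order_tendstoD(1)[OF LIMSEQ_Suc[OF a], of "1 / 4"] by simp
  ultimately have "\<forall>\<^sub>F n in sequentially. L (P n * P n) \<le> 16 * L (P (Suc n) * P (Suc n))"
    by (auto elim: eventually_mono)
  with orth dP show ?thesis
    by (intro exI[of _ P]) (auto simp: orthogonal_monic_def)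
qed

text \<open>
  The points of \<open>X\<close> and one zero from each \<open>V j\<close> are at least \<open>n\<close> distinct elements of the multiset of zeros,
  which has size \<open>n\<close>.
\<close>
lemma czeros_exhausted:
  assumes S: "S \<noteq> 0" "degree S = n" and X: "finite X" "X \<subseteq> {-1<..<1}" "\<And>x. x \<in> X \<Longrightarrow> poly S x = 0"
    and card: "n \<le> card X + card J" and J: "finite J"
    and V: "\<And>j. j \<in> J \<Longrightarrow> V j \<inter> complex_of_real ` {-1..1} = {}"
      "\<And>i j. \<lbrakk>i \<in> J; j \<in> J; i \<noteq> j\<rbrakk> \<Longrightarrow> V i \<inter> V j = {}"
    and zero: "\<And>j. j \<in> J \<Longrightarrow> \<exists>z\<in>V j. poly (cpoly S) z = 0"
  shows "(\<forall>j\<in>J. size {#z \<in># czeros S. z \<in> V j#} = 1) \<and>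
     size {#z \<in># czeros S. z \<notin> (\<Union>j\<in>J. V j)#} = n - card J \<and>
     (\<forall>z\<in>#czeros S. z \<notin> (\<Union>j\<in>J. V j) \<longrightarrow> z \<in> complex_of_real ` {-1<..<1}) \<and>
     (\<forall>z\<in>#czeros S. count (czeros S) z = 1)"
proof -
  obtain f where f: "\<And>j. j \<in> J \<Longrightarrow> f j \<in> V j \<and> poly (cpoly S) (f j) = 0"
    using zero by metis
  let ?X = "complex_of_real ` X"
  have injf: "inj_on f J" using f V(2) by (fastforce simp: inj_on_def)
  have X_out: "z \<notin> V j" if "z \<in> ?X" "j \<in> J" for z j
    using V(1)[OF that(2)] that(1) X(2) by fastforce
  have disj: "?X \<inter> f ` J = {}"
  proof (rule equals0I)
    fix z assume z: "z \<in> ?X \<inter> f ` J"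
    then obtain j where "j \<in> J" "z = f j" by blast
    then show False using X_out[of z j] f[of j] z by simp
  qed
  have cX: "card ?X = card X" by (intro card_image) (simp add: inj_on_def)
  have cards: "card (?X \<union> f ` J) = card X + card J"
    using disj X(1) J cX injf by (simp add: card_Un_disjoint card_image)
  have "?X \<union> f ` J \<subseteq> set_mset (czeros S)"
    using X(3) f by (auto simp: czeros_mem_iff[OF S(1)] poly_cpoly)
  then have "mset_set (?X \<union> f ` J) \<subseteq># mset_set (set_mset (czeros S))"
    by (intro subset_imp_msubset_mset_set) simp_all
  then have sub: "mset_set (?X \<union> f ` J) \<subseteq># czeros S"
    using mset_set_set_mset_msubset subset_mset.order_trans by blast
  moreover have "size (czeros S) \<le> size (mset_set (?X \<union> f ` J))"
    using card S(2) cards by (simp add: size_czeros)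
  ultimately have eq: "czeros S = mset_set (?X \<union> f ` J)"
    using mset_subset_size not_le subset_mset.le_neq_trans by metis
  have n: "n = card X + card J"
    using arg_cong[OF eq, of size] S(2) cards by (simp add: size_czeros)
  have fin: "finite (?X \<union> f ` J)" using X(1) J by simp
  have "{z \<in> ?X \<union> f ` J. z \<in> V j} = {f j}" if "j \<in> J" for j
    using that f V(2) X_out by fastforce
  then have "\<forall>j\<in>J. size {#z \<in># czeros S. z \<in> V j#} = 1"
    unfolding eq using fin by (simp add: filter_mset_mset_set)
  moreover have out: "{z \<in> ?X \<union> f ` J. z \<notin> (\<Union>j\<in>J. V j)} = ?X"
    using f X_out by blast
  then have "size {#z \<in># czeros S. z \<notin> (\<Union>j\<in>J. V j)#} = n - card J"
    unfolding eq using fin n cX by (simp only: filter_mset_mset_set size_mset_set)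
  moreover have "\<forall>z\<in>#czeros S. z \<notin> (\<Union>j\<in>J. V j) \<longrightarrow> z \<in> complex_of_real ` {-1<..<1}"
  proof (intro ballI impI)
    fix z assume "z \<in># czeros S" "z \<notin> (\<Union>j\<in>J. V j)"
    then have "z \<in> {z \<in> ?X \<union> f ` J. z \<notin> (\<Union>j\<in>J. V j)}"
      unfolding eq using fin by simp
    then show "z \<in> complex_of_real ` {-1<..<1}" unfolding out using X(2) by blast
  qed
  moreover have "\<forall>z\<in>#czeros S. count (czeros S) z = 1"
    unfolding eq using fin by simp
  ultimately show ?thesis by blast
qed

lemma exists_separating_radius:
  fixes c :: "'i \<Rightarrow> real"
  assumes J: "finite J" "inj_on c J" "\<And>j. j \<in> J \<Longrightarrow> 1 < \<bar>c j\<bar>"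
  shows "\<exists>\<epsilon>>0. (\<forall>j\<in>J. ball (complex_of_real (c j)) \<epsilon> \<inter> complex_of_real ` {-1..1} = {}) \<and>
     (\<forall>i\<in>J. \<forall>j\<in>J. i \<noteq> j \<longrightarrow> ball (complex_of_real (c i)) \<epsilon> \<inter> ball (complex_of_real (c j)) \<epsilon> = {})"
proof -
  define R where "R = insert 1 ((\<lambda>j. \<bar>c j\<bar> - 1) ` J \<union>
    (\<lambda>(i, j). \<bar>c i - c j\<bar> / 2) ` {(i, j) \<in> J \<times> J. i \<noteq> j})"
  have "finite {(i, j) \<in> J \<times> J. i \<noteq> j}" using J(1) by (auto intro: finite_subset[of _ "J \<times> J"])
  then have R: "finite R" "R \<noteq> {}" using J(1) by (auto simp: R_def)
  have "0 < r" if "r \<in> R" for r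
    using that J(2,3) by (fastforce simp: R_def inj_on_def)
  then have pos: "0 < Min R" using R by simp
  have le1: "Min R \<le> \<bar>c j\<bar> - 1" if "j \<in> J" for j using R that by (intro Min_le) (auto simp: R_def)
  have le2: "Min R \<le> \<bar>c i - c j\<bar> / 2" if "i \<in> J" "j \<in> J" "i \<noteq> j" for i j
    using R that by (intro Min_le) (auto simp: R_def intro!: image_eqI[of _ _ "(i, j)"])
  have "ball (complex_of_real (c j)) (Min R) \<inter> complex_of_real ` {-1..1} = {}" if "j \<in> J" for j
  proof (rule equals0I)
    fix z assume "z \<in> ball (complex_of_real (c j)) (Min R) \<inter> complex_of_real ` {-1..1}"
    then obtain x where "x \<in> {-1..1}" "dist (complex_of_real (c j)) (complex_of_real x) < Min R" by auto
    then have "\<bar>c j - x\<bar> < \<bar>c j\<bar> - 1" using le1[OF that] by (simp add: dist_of_real dist_real_def)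
    with \<open>x \<in> {-1..1}\<close> show False by auto
  qed
  moreover have "ball (complex_of_real (c i)) (Min R) \<inter> ball (complex_of_real (c j)) (Min R) = {}"
    if "i \<in> J" "j \<in> J" "i \<noteq> j" for i j
  proof (rule disjoint_ballI)
    show "Min R + Min R \<le> dist (complex_of_real (c i)) (complex_of_real (c j))"
      using le2[OF that] by (simp add: dist_of_real dist_real_def)
  qed
  ultimately show ?thesis using pos by blast
qed

theorem lemma3p4:
  fixes M :: "real measure" and N :: nat and \<eta> c :: "nat \<Rightarrow> real" and d :: "nat \<Rightarrow> nat"
    and S :: "nat \<Rightarrow> real poly"
  assumes "borel_measure_on_Icc M"
    and "infinite (measure_support M)"
    and "\<And>j. j \<in> {1..N} \<Longrightarrow> \<eta> j > 0"
    and "\<And>j. j \<in> {1..N} \<Longrightarrow> c j \<notin> {-1..1}"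
    and "sequentially_ordered N c d"
    and "nevai_class_0_1 M"
    and "monic_orthogonal (sobolev_ip M N \<eta> c d) S"
  shows
    "(\<exists>\<epsilon>>0. \<forall>V :: nat \<Rightarrow> complex set.
        (\<forall>j\<in>{1..N}. complex_of_real (c j) \<in> interior (V j) \<and>
                     V j \<subseteq> ball (complex_of_real (c j)) \<epsilon>) \<longrightarrow>
        (\<forall>\<^sub>F n in sequentially.
           (\<forall>j\<in>{1..N}. size {#z \<in># czeros (S n). z \<in> V j#} = 1) \<and>
           size {#z \<in># czeros (S n). z \<notin> (\<Union>j\<in>{1..N}. V j)#} = n - N \<and>
           (\<forall>z \<in># czeros (S n). z \<notin> (\<Union>j\<in>{1..N}. V j) \<longrightarrow>
              z \<in> complex_of_real ` {-1<..<1}))) \<and>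
     (\<forall>\<^sub>F n in sequentially. \<forall>z \<in># czeros (S n). z \<in> \<real> \<and> count (czeros (S n)) z = 1) \<and>
     (\<exists>C. \<forall>n\<ge>1. \<forall>z \<in># czeros (S n). norm z \<le> C)"
proof -
  define L where "L = (\<lambda>p. LINT x:{-1..1}|M. poly p x)"
  have supp: "measure_support M = {-1..1}" using assms(6) by (simp add: nevai_class_0_1_def)
  interpret positive_functional L
    unfolding L_def by (rule positive_functional_integral[OF assms(1) supp])
  have nest: "nested_constraints {1..N} c d" by (rule sequentially_ordered_imp_nested) fact
  have c: "1 < \<bar>c j\<bar>" if "j \<in> {1..N}" for j using assms(4)[OF that] by auto
  have S: "degree (S n) = n" "lead_coeff (S n) = 1" for n
    using assms(7) unfolding monic_orthogonal_def by blast+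
  have S0: "S n \<noteq> 0" for n using S(2)[of n] by auto
  have ip: "sobolev_ip M N \<eta> c d p q = L (p * q) + (\<Sum>j\<in>{1..N}. \<eta> j *
      poly ((pderiv ^^ d j) p) (c j) * poly ((pderiv ^^ d j) q) (c j))" for p q
  proof -
    have "poly (p * q) = (\<lambda>x. poly p x * poly q x)" by (simp add: fun_eq_iff)
    then show ?thesis by (simp add: sobolev_ip_def L_def)
  qed
  have "linfun (\<lambda>q. sobolev_ip M N \<eta> c d q r)" for r
    unfolding ip using linear
    by (simp add: linfun_def higher_pderiv_add higher_pderiv_smult algebra_simps sum.distrib sum_distrib_left)
  then have orth: "sobolev_ip M N \<eta> c d q (S n) = 0" if "degree q < n" for q n
    using monic_orthogonal_imp_orthogonal[OF assms(7)] that by blast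
  obtain P where P: "\<And>n. orthogonal_monic (P n) n"
    and ratio: "\<forall>\<^sub>F n in sequentially. L (P n * P n) \<le> 16 * L (P (Suc n) * P (Suc n))"
    using nevai_norm_ratio[OF assms(1,6)] unfolding L_def by blast
  have near: "\<forall>\<^sub>F n in sequentially. \<exists>z. poly (cpoly (S n)) z = 0 \<and> norm (of_real (c j) - z) < \<delta>"
    if "j \<in> {1..N}" "0 < \<delta>" for j \<delta>
  proof (rule sobolev_zero_near_mass_point[OF nest assms(3) c S _ P ratio that])
    show "L (q * S n) + (\<Sum>i\<in>{1..N}. \<eta> i * poly ((pderiv ^^ d i) q) (c i) *
        poly ((pderiv ^^ d i) (S n)) (c i)) = 0" if "degree q < n" for n q
      using orth[OF that] unfolding ip .
  qed
  have inside: "\<exists>X. finite X \<and> X \<subseteq> {-1<..<1} \<and> (\<forall>x\<in>X. poly (S n) x = 0) \<and> n \<le> card X + card {1..N}" for n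
  proof (rule exists_zeros_inside[OF nest S0])
    fix q :: "real poly"
    assume q: "degree q < n" "\<And>j. j \<in> {1..N} \<Longrightarrow> poly ((pderiv ^^ d j) q) (c j) = 0"
    have "(\<Sum>j\<in>{1..N}. \<eta> j * poly ((pderiv ^^ d j) q) (c j) * poly ((pderiv ^^ d j) (S n)) (c j)) = 0"
      using q(2) by (intro sum.neutral) simp
    then show "L (q * S n) = 0" using orth[OF q(1)] unfolding ip by simp
  qed
  obtain \<epsilon> where \<epsilon>: "0 < \<epsilon>"
    "\<And>j. j \<in> {1..N} \<Longrightarrow> ball (complex_of_real (c j)) \<epsilon> \<inter> complex_of_real ` {-1..1} = {}"
    "\<And>i j. \<lbrakk>i \<in> {1..N}; j \<in> {1..N}; i \<noteq> j\<rbrakk> \<Longrightarrow>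
      ball (complex_of_real (c i)) \<epsilon> \<inter> ball (complex_of_real (c j)) \<epsilon> = {}"
    using exists_separating_radius[of "{1..N}" c] nest c unfolding nested_constraints_def by auto
  have main: "\<forall>\<^sub>F n in sequentially.
      (\<forall>j\<in>{1..N}. size {#z \<in># czeros (S n). z \<in> V j#} = 1) \<and>
      size {#z \<in># czeros (S n). z \<notin> (\<Union>j\<in>{1..N}. V j)#} = n - N \<and>
      (\<forall>z\<in>#czeros (S n). z \<notin> (\<Union>j\<in>{1..N}. V j) \<longrightarrow> z \<in> complex_of_real ` {-1<..<1}) \<and>
      (\<forall>z\<in>#czeros (S n). count (czeros (S n)) z = 1)"
    if V: "\<And>j. j \<in> {1..N} \<Longrightarrow> complex_of_real (c j) \<in> interior (V j) \<and>
                     V j \<subseteq> ball (complex_of_real (c j)) \<epsilon>" for V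
  proof -
    have "\<forall>\<^sub>F n in sequentially. \<forall>j\<in>{1..N}. \<exists>z\<in>V j. poly (cpoly (S n)) z = 0"
    proof (intro eventually_ball_finite ballI)
      fix j assume j: "j \<in> {1..N}"
      then obtain \<delta> where "0 < \<delta>" "ball (complex_of_real (c j)) \<delta> \<subseteq> V j"
        using V[OF j] unfolding mem_interior by blast
      then show "\<forall>\<^sub>F n in sequentially. \<exists>z\<in>V j. poly (cpoly (S n)) z = 0"
        using near[OF j \<open>0 < \<delta>\<close>] by (auto elim!: eventually_mono simp: dist_norm subset_iff)
    qed simp
    then show ?thesis
    proof eventually_elim
      case (elim n)
      obtain X where X: "finite X" "X \<subseteq> {-1<..<1}" "\<And>x. x \<in> X \<Longrightarrow> poly (S n) x = 0"
        "n \<le> card X + card {1..N}" using inside[of n] by blast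
      have "V j \<inter> complex_of_real ` {-1..1} = {}" if "j \<in> {1..N}" for j
        using \<epsilon>(2)[OF that] V[OF that] by blast
      moreover have "V i \<inter> V j = {}" if "i \<in> {1..N}" "j \<in> {1..N}" "i \<noteq> j" for i j
        using \<epsilon>(3)[OF that] V[OF that(1)] V[OF that(2)] by blast
      ultimately show ?case
        using czeros_exhausted[OF S0 S(1) X _ , of V] elim by simp
    qed
  qed
  define U where "U j = ball (complex_of_real (c j)) \<epsilon>" for j
  have mainU: "\<forall>\<^sub>F n in sequentially.
      (\<forall>j\<in>{1..N}. size {#z \<in># czeros (S n). z \<in> U j#} = 1) \<and>
      (\<forall>z\<in>#czeros (S n). z \<notin> (\<Union>j\<in>{1..N}. U j) \<longrightarrow> z \<in> complex_of_real ` {-1<..<1}) \<and>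
      (\<forall>z\<in>#czeros (S n). count (czeros (S n)) z = 1)"
    by (rule eventually_mono[OF main[of U]]) (auto simp: U_def \<epsilon>(1))
  have real: "\<forall>\<^sub>F n in sequentially. \<forall>z\<in>#czeros (S n). z \<in> \<real> \<and> count (czeros (S n)) z = 1"
    using mainU
  proof eventually_elim
    case (elim n)
    have "z \<in> \<real>" if z: "z \<in># czeros (S n)" for z
    proof (cases "\<exists>j\<in>{1..N}. z \<in> U j")
      case True
      then obtain j where j: "j \<in> {1..N}" "z \<in> U j" by blast
      \<comment> \<open>The disc \<open>U j\<close> is symmetric about the real axis and contains only one zero.\<close>
      have "cnj z \<in># czeros (S n)" using z by (simp add: czeros_mem_iff[OF S0] poly_cpoly_cnj)
      moreover have "cnj z \<in> U j"
      proof -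
        have "cnj (complex_of_real (c j) - z) = complex_of_real (c j) - cnj z" by simp
        then show ?thesis using j(2) complex_mod_cnj[of "complex_of_real (c j) - z"]
          by (simp add: U_def dist_norm)
      qed
      moreover obtain y where "{#z \<in># czeros (S n). z \<in> U j#} = {#y#}"
        using elim j(1) size_1_singleton_mset by blast
      ultimately have "cnj z = z" using z j(2)
        by (metis (mono_tags, lifting) count_single filter_mset_eq_conv mem_Collect_eq set_mset_filter set_mset_single singletonD)
      then show ?thesis by (simp add: Reals_cnj_iff)
    next
      case False
      then show ?thesis using elim z by auto
    qed
    with elim show ?case by blast
  qed
  have bounded: "\<exists>C. \<forall>n\<ge>1. \<forall>z\<in>#czeros (S n). norm z \<le> C"
  proof -
    obtain n0 where n0: "\<And>n z. \<lbrakk>n0 \<le> n; z \<in># czeros (S n); z \<notin> (\<Union>j\<in>{1..N}. U j)\<rbrakk>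
        \<Longrightarrow> z \<in> complex_of_real ` {-1<..<1}"
      using mainU unfolding eventually_sequentially by blast
    define A where "A = (\<Union>n<n0. set_mset (czeros (S n))) \<union> (\<Union>j\<in>{1..N}. U j) \<union> cball 0 1"
    have "bounded A" unfolding A_def U_def
      by (intro bounded_Un[THEN iffD2] conjI bounded_UN bounded_ball bounded_cball finite_imp_bounded) auto
    then obtain C where C: "\<And>z. z \<in> A \<Longrightarrow> norm z \<le> C" by (auto simp: bounded_iff)
    have "z \<in> A" if "z \<in># czeros (S n)" for n z
    proof (cases "n < n0")
      case False
      then show ?thesis using n0[of n z] that by (fastforce simp: A_def)
    qed (use that in \<open>auto simp: A_def\<close>)
    with C show ?thesis by blast
  qed
  have part1: "\<exists>\<epsilon>>0. \<forall>V :: nat \<Rightarrow> complex set.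
        (\<forall>j\<in>{1..N}. complex_of_real (c j) \<in> interior (V j) \<and>
                     V j \<subseteq> ball (complex_of_real (c j)) \<epsilon>) \<longrightarrow>
        (\<forall>\<^sub>F n in sequentially.
           (\<forall>j\<in>{1..N}. size {#z \<in># czeros (S n). z \<in> V j#} = 1) \<and>
           size {#z \<in># czeros (S n). z \<notin> (\<Union>j\<in>{1..N}. V j)#} = n - N \<and>
           (\<forall>z \<in># czeros (S n). z \<notin> (\<Union>j\<in>{1..N}. V j) \<longrightarrow>
              z \<in> complex_of_real ` {-1<..<1}))"
  proof (intro exI[of _ \<epsilon>] conjI allI impI)
    fix V :: "nat \<Rightarrow> complex set"
    assume "\<forall>j\<in>{1..N}. complex_of_real (c j) \<in> interior (V j) \<and> V j \<subseteq> ball (complex_of_real (c j)) \<epsilon>"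
    then show "\<forall>\<^sub>F n in sequentially.
           (\<forall>j\<in>{1..N}. size {#z \<in># czeros (S n). z \<in> V j#} = 1) \<and>
           size {#z \<in># czeros (S n). z \<notin> (\<Union>j\<in>{1..N}. V j)#} = n - N \<and>
           (\<forall>z \<in># czeros (S n). z \<notin> (\<Union>j\<in>{1..N}. V j) \<longrightarrow>
              z \<in> complex_of_real ` {-1<..<1})"
      by (intro eventually_mono[OF main[of V]]) blast+
  qed (rule \<epsilon>(1))
  from part1 real bounded show ?thesis by blast
qed

end
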